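(* Let $\mathsf{Cat}_1$ be a nice metric-algebraic category with $\mathsf{Banach}\subseteq \mathsf{Cat}_1$. Let $X$ be a real Banach space, $Y\subseteq X$ a closed subspace, $\lambda\ge 1$, and let $j\colon Y\to Y^{**}$ be the canonical embedding. The following are equivalent: (1) For every dual Banach space $Z^*$ and every $\mathsf{Cat}_1$-morphism $f\colon Y\to Z^*$ there exists a $\mathsf{Cat}_1$-morphism $h\colon X\to Z^*$ with $h|_Y=f$ and $\|h\|\le \lambda\|f\|$. (2) There is a $\mathsf{Cat}_1$-morphism $h\colon X\to Y^{**}$ with $\|h\|\le\lambda$ and $h|_Y=j$. (3) For every $\varepsilon>0$ and every finite set $G\subseteq X$ there exist a subset $V$ with $G\subseteq V\subseteq X$ which is an object of $\mathsf{Cat}_1$ with the metric and operations inherited from $X$, and a $\mathsf{Cat}_1$-morphism $\varphi\colon V\to Y$ with $\|\varphi\|\le\lambda(1+\varepsilon)$ and $\varphi(e)=e$ for every $e\in V\cap Y$. (4) For every $\varepsilon>0$ and every finite set $G\subseteq X$ there exist a subset $V$ with $G\subseteq V\subseteq X$ which is an object of $\mathsf{Cat}_1$ with the metric and operations inherited from $X$, and a $\mathsf{Cat}_1$-morphism $\varphi\colon V\to Y$ with $\|\varphi\|\le\lambda(1+\varepsilon)$ and $\|\varphi(e)-e\|<\varepsilon$ for every $e\in V\cap Y$.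
   Context: A metric-algebraic category is specified by an index set $I$, arities $n_i\in\{0,1,2,\dots\}$ ($i\in I$) and a set of axioms; its objects are tuples $(X,d,\{\sigma_i\}_{i\in I})$ with $d$ a metric on $X$ and $\sigma_i\colon X^{n_i}\to X$ operations satisfying the axioms, and its morphisms $T\colon (X,d,\{\sigma_i\})\to(Y,d',\{\tau_i\})$ are the maps that are Lipschitz, with norm $\|T\|=\sup\{d'(Tx,Ty)/d(x,y): x\neq y\}<\infty$, and satisfy $T(\sigma_i(x_1,\dots,x_{n_i}))=\tau_i(Tx_1,\dots,Tx_{n_i})$ for all $i$ and all $x_1,\dots,x_{n_i}$. For two such categories, $\mathsf{Cat}_2\subseteq\mathsf{Cat}_1$ means that the list of operations and axioms defining $\mathsf{Cat}_2$ contains the list defining $\mathsf{Cat}_1$; thus every $\mathsf{Cat}_2$-object is a $\mathsf{Cat}_1$-object (forgetting operations) and every $\mathsf{Cat}_2$-morphism is a $\mathsf{Cat}_1$-morphism. $\mathsf{Banach}$ is the metric-algebraic category of real Banach spaces, with metric induced by the norm and with operations the linear combinations $(x_1,\dots,x_n)\mapsto r_1x_1+\dots+r_nx_n$ ($r_k\in\mathbb R$), whose morphisms are exactly the bounded linear operators. Thus when $\mathsf{Banach}\subseteq\mathsf{Cat}_1$, every Banach space is a $\mathsf{Cat}_1$-object, every bounded operator is a $\mathsf{Cat}_1$-morphism, and every operation of $\mathsf{Cat}_1$ is some linear combination (for example $\mathsf{Cat}_1=\mathsf{Metric}$, pointed metric spaces with Lipschitz maps preserving the base point $0$). A metric-algebraic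 category $\mathsf{Cat}_1$ is nice if whenever $f\colon A\to B$ is a $\mathsf{Cat}_1$-morphism and $D\subseteq B$ is a $\mathsf{Cat}_1$-object with the operations inherited from $B$, then $f^{-1}(D)$ is a $\mathsf{Cat}_1$-object with the operations inherited from $A$. *)

theory Defs
  imports "HOL-Analysis.Analysis"
begin

text \<open>Since Banach is contained in Cat1, every operation of Cat1 is a linear combination
  (x1,...,xn) maps to r1 x1 + ... + rn xn; such an operation is coded by its coefficient
  list [r1,...,rn] (arity = length of the list).  Ops is the set of operations of Cat1.\<close>

definition lincomb :: "real list \<Rightarrow> 'a::real_vector list \<Rightarrow> 'a" where
  "lincomb rs xs = sum_list (map2 (\<lambda>r x. r *\<^sub>R x) rs xs)"

definition op_closed :: "real list set \<Rightarrow> 'a::real_vector set \<Rightarrow> bool" where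
  "op_closed Ops V \<longleftrightarrow>
     (\<forall>rs\<in>Ops. \<forall>xs. length xs = length rs \<and> set xs \<subseteq> V \<longrightarrow> lincomb rs xs \<in> V)"

text \<open>A subset V of a normed space is a Cat1-object with the inherited metric and
  operations: it is closed under the operations and satisfies the axioms Ax of Cat1.\<close>
definition cat_obj :: "real list set \<Rightarrow> ('a::real_normed_vector set \<Rightarrow> bool) \<Rightarrow> 'a set \<Rightarrow> bool" where
  "cat_obj Ops Ax V \<longleftrightarrow> op_closed Ops V \<and> Ax V"

definition cat_mor :: "real list set \<Rightarrow> 'a::real_normed_vector set \<Rightarrow> 'b::real_normed_vector set
    \<Rightarrow> ('a \<Rightarrow> 'b) \<Rightarrow> bool" where
  "cat_mor Ops V W f \<longleftrightarrow> f ` V \<subseteq> W \<and> (\<exists>C. C-lipschitz_on V f) \<and>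
     (\<forall>rs\<in>Ops. \<forall>xs. length xs = length rs \<and> set xs \<subseteq> V \<longrightarrow>
        f (lincomb rs xs) = lincomb rs (map f xs))"

text \<open>Lipschitz norm sup { d(f x, f y) / d(x,y) : x \<noteq> y } (0 if V has at most one point).\<close>
definition lip_norm :: "'a::metric_space set \<Rightarrow> ('a \<Rightarrow> 'b::metric_space) \<Rightarrow> real" where
  "lip_norm V f = Sup (insert 0 {dist (f x) (f y) / dist x y | x y. x \<in> V \<and> y \<in> V \<and> x \<noteq> y})"

definition canon_emb :: "'a::real_normed_vector \<Rightarrow> ('a \<Rightarrow>\<^sub>L real) \<Rightarrow>\<^sub>L real" where
  "canon_emb y = Blinfun (\<lambda>g. blinfun_apply g y)"

text \<open>Condition (1) for the dual space Z* = ('z \<Rightarrow>L real), where Y is the type 'y embedded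
  in X = 'x isometrically by iota.\<close>
definition ext_prop :: "real list set \<Rightarrow> ('y::real_normed_vector \<Rightarrow> 'x::real_normed_vector)
    \<Rightarrow> real \<Rightarrow> 'z::real_normed_vector itself \<Rightarrow> bool" where
  "ext_prop Ops iota lam (_::'z itself) \<longleftrightarrow>
     (\<forall>f :: 'y \<Rightarrow> ('z \<Rightarrow>\<^sub>L real). cat_mor Ops UNIV UNIV f \<longrightarrow>
        (\<exists>h :: 'x \<Rightarrow> ('z \<Rightarrow>\<^sub>L real). cat_mor Ops UNIV UNIV h \<and>
            (\<forall>y. h (iota y) = f y) \<and> lip_norm UNIV h \<le> lam * lip_norm UNIV f))"

end

theory Submission
  imports Defs
begin

text \<open>The bridge between finite and global extensions is the principle of local reflexivity: every
  finite-dimensional subspace of \<open>Y**\<close> admits a linear map into \<open>Y\<close> of norm at most \<open>1 + \<epsilon>\<close> that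
  inverts the canonical embedding. Composing it with a morphism \<open>h : X \<rightarrow> Y**\<close> on the preimage of the
  span of \<open>h(G)\<close>, an object because the category is nice, turns (2) into (3). Conversely, given local
  almost-retractions \<open>\<phi>\<close> and a morphism \<open>f : Y \<rightarrow> Z*\<close>, the maps \<open>f \<circ> \<phi>\<close> stay bounded at each point,
  so they have a pointwise weak* cluster point along the finite sets \<open>G\<close> and \<open>\<epsilon> \<rightarrow> 0\<close>; it extends \<open>f\<close>
  and preserves the operations because these are linear combinations, hence (4) gives (1).

  Local reflexivity on a finite set \<open>N\<close> of functionals of norm at most 1 is a separation argument: if the
  tuples \<open>(T n)\<close> for linear left inverses \<open>T\<close> of the embedding all had norm at least \<open>1 + \<epsilon>\<close>, a
  Hahn-Banach functional, i.e. a tuple of functionals on \<open>Y\<close> of total norm at most 1, would separate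
  this affine space from the ball, contradicting that the tuple \<open>N\<close> itself has norm at most 1.\<close>

subsection \<open>The Hahn-Banach theorem\<close>

text \<open>Homogeneity is asked only as an inequality for \<open>c > 0\<close>, which is what an
  infimum argument yields; applying it to \<open>inverse c\<close> as well recovers
  equality.\<close>

definition sublinear :: "('a::real_vector \<Rightarrow> real) \<Rightarrow> bool" where
  "sublinear q \<longleftrightarrow> (\<forall>x y. q (x + y) \<le> q x + q y) \<and> (\<forall>c>0. \<forall>x. q (c *\<^sub>R x) \<le> c * q x)"

lemma sublinear_add: "sublinear q \<Longrightarrow> q (x + y) \<le> q x + q y"
  by (simp add: sublinear_def)

lemma sublinear_zero: assumes "sublinear q" shows "q 0 = 0"
proof -
  have "\<And>c. c > 0 \<Longrightarrow> q 0 \<le> c * q 0"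
    using assms unfolding sublinear_def by (metis scaleR_zero_right)
  from this[of 2] this[of "1/2"] show ?thesis by simp
qed

lemma sublinear_scaleR:
  assumes "sublinear q" "c \<ge> 0" shows "q (c *\<^sub>R x) = c * q x"
proof (cases "c = 0")
  case True
  then show ?thesis using sublinear_zero[OF assms(1)] by simp
next
  case False
  with assms have "c > 0" by simp
  have "q (inverse c *\<^sub>R (c *\<^sub>R x)) \<le> inverse c * q (c *\<^sub>R x)"
    using assms \<open>c > 0\<close> unfolding sublinear_def by (meson positive_imp_inverse_positive)
  then have "c * q x \<le> q (c *\<^sub>R x)" using \<open>c > 0\<close> by (simp add: field_simps)
  moreover have "q (c *\<^sub>R x) \<le> c * q x" using assms \<open>c > 0\<close> unfolding sublinear_def by blast
  ultimately show ?thesis by simp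
qed

lemma sublinear_ge: assumes "sublinear q" shows "- q (- x) \<le> q x"
  using sublinear_add[OF assms, of x "- x"] sublinear_zero[OF assms] by simp

text \<open>The largest sublinear functional below \<open>q\<close> that is linear along the ray of \<open>x\<close>, in the
  sense that \<open>tilt q x (- x) = - q x\<close>. A minimal \<open>q\<close> equals all its tilts, which makes it additive.\<close>
definition tilt :: "('a::real_vector \<Rightarrow> real) \<Rightarrow> 'a \<Rightarrow> 'a \<Rightarrow> real" where
  "tilt q x z = (INF t\<in>{0..}. q (z + t *\<^sub>R x) - t * q x)"

lemma tilt_bdd:
  assumes "sublinear q" shows "bdd_below ((\<lambda>t. q (z + t *\<^sub>R x) - t * q x) ` {0..})"
proof (rule bdd_belowI2)
  fix t :: real assume "t \<in> {0..}"
  then have "t * q x \<le> q (z + t *\<^sub>R x) + q (- z)"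
    using sublinear_add[OF assms, of "z + t *\<^sub>R x" "- z"] sublinear_scaleR[OF assms, of t x] by simp
  then show "- q (- z) \<le> q (z + t *\<^sub>R x) - t * q x" by simp
qed

lemma tilt_le: "sublinear q \<Longrightarrow> t \<ge> 0 \<Longrightarrow> tilt q x z \<le> q (z + t *\<^sub>R x) - t * q x"
  unfolding tilt_def by (rule cINF_lower[OF tilt_bdd]) auto

lemma tilt_greatest:
  "(\<And>t. t \<ge> 0 \<Longrightarrow> m \<le> q (z + t *\<^sub>R x) - t * q x) \<Longrightarrow> m \<le> tilt q x z"
  unfolding tilt_def by (rule cINF_greatest) auto

text \<open>Parameters \<open>s\<close> for \<open>y\<close> and \<open>t\<close> for
  \<open>z\<close> add up to \<open>s + t\<close> for \<open>y + z\<close>, and \<open>t\<close> for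
  \<open>z\<close> matches \<open>c * t\<close> for the multiple of \<open>z\<close> by
  \<open>c\<close>; the infima are then taken one variable at a time.\<close>

lemma sublinear_tilt: assumes "sublinear q" shows "sublinear (tilt q x)"
  unfolding sublinear_def
proof (intro conjI allI impI)
  fix y z
  have "tilt q x (y + z) - (q (z + t *\<^sub>R x) - t * q x) \<le> tilt q x y" if "t \<ge> 0" for t
  proof (rule tilt_greatest)
    fix s :: real assume "s \<ge> 0"
    have "tilt q x (y + z) \<le> q ((y + z) + (s + t) *\<^sub>R x) - (s + t) * q x"
      using tilt_le[OF assms] \<open>s \<ge> 0\<close> that by simp
    also have "(y + z) + (s + t) *\<^sub>R x = (y + s *\<^sub>R x) + (z + t *\<^sub>R x)"
      by (simp add: algebra_simps)
    finally show "tilt q x (y + z) - (q (z + t *\<^sub>R x) - t * q x) \<le> q (y + s *\<^sub>R x) - s * q x"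
      using sublinear_add[OF assms, of "y + s *\<^sub>R x" "z + t *\<^sub>R x"] by (simp add: algebra_simps)
  qed
  then have "tilt q x (y + z) - tilt q x y \<le> tilt q x z"
    by (intro tilt_greatest) (simp add: algebra_simps)
  then show "tilt q x (y + z) \<le> tilt q x y + tilt q x z" by simp
next
  fix c :: real and z assume "c > 0"
  have "tilt q x (c *\<^sub>R z) / c \<le> tilt q x z"
  proof (rule tilt_greatest)
    fix t :: real assume "t \<ge> 0"
    have "tilt q x (c *\<^sub>R z) \<le> q (c *\<^sub>R z + (c * t) *\<^sub>R x) - (c * t) * q x"
      using tilt_le[OF assms] \<open>c > 0\<close> \<open>t \<ge> 0\<close> by simp
    also have "c *\<^sub>R z + (c * t) *\<^sub>R x = c *\<^sub>R (z + t *\<^sub>R x)" by (simp add: algebra_simps)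
    also have "q \<dots> = c * q (z + t *\<^sub>R x)" using sublinear_scaleR[OF assms] \<open>c > 0\<close> by simp
    finally show "tilt q x (c *\<^sub>R z) / c \<le> q (z + t *\<^sub>R x) - t * q x"
      using \<open>c > 0\<close> by (simp add: field_simps)
  qed
  then show "tilt q x (c *\<^sub>R z) \<le> c * tilt q x z" using \<open>c > 0\<close> by (simp add: field_simps)
qed

text \<open>Infima of sublinear functionals need not be subadditive. In a chain, \<open>q\<close>
  and \<open>r\<close> may both be replaced by the smaller one, which is itself subadditive.\<close>

lemma sublinear_INF_chain:
  assumes "C \<noteq> {}" and sub: "\<And>q. q \<in> C \<Longrightarrow> sublinear q"
    and chain: "\<And>q r. q \<in> C \<Longrightarrow> r \<in> C \<Longrightarrow> q \<le> r \<or> r \<le> q"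
    and bdd: "\<And>x. bdd_below ((\<lambda>q. q x) ` C)"
  shows "sublinear (\<lambda>x. INF q\<in>C. q x)"
  unfolding sublinear_def
proof (intro conjI allI impI)
  fix x y
  have le: "(INF q\<in>C. q (x + y)) \<le> q x + r y" if qr: "q \<in> C" "r \<in> C" for q r
  proof -
    obtain s where s: "s \<in> C" "s \<le> q" "s \<le> r" using chain qr by blast
    have "(INF q\<in>C. q (x + y)) \<le> s (x + y)" using bdd s by (intro cINF_lower)
    also have "\<dots> \<le> s x + s y" using sub s sublinear_add by blast
    also have "\<dots> \<le> q x + r y" using s by (intro add_mono) (auto simp: le_fun_def)
    finally show ?thesis .
  qed
  have "(INF q\<in>C. q (x + y)) - r y \<le> (INF q\<in>C. q x)" if "r \<in> C" for r
    using assms(1) le that by (intro cINF_greatest) (auto simp: algebra_simps)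
  then have "(INF q\<in>C. q (x + y)) - (INF q\<in>C. q x) \<le> (INF q\<in>C. q y)"
    using assms(1) by (intro cINF_greatest) (auto simp: algebra_simps)
  then show "(INF q\<in>C. q (x + y)) \<le> (INF q\<in>C. q x) + (INF q\<in>C. q y)" by simp
next
  fix c :: real and x assume "c > 0"
  have "(INF q\<in>C. q (c *\<^sub>R x)) / c \<le> (INF q\<in>C. q x)"
  proof (rule cINF_greatest[OF assms(1)])
    fix q assume "q \<in> C"
    then have "(INF q\<in>C. q (c *\<^sub>R x)) \<le> q (c *\<^sub>R x)" using bdd by (intro cINF_lower)
    also have "\<dots> = c * q x" using sub \<open>q \<in> C\<close> \<open>c > 0\<close> by (simp add: sublinear_scaleR)
    finally show "(INF q\<in>C. q (c *\<^sub>R x)) / c \<le> q x" using \<open>c > 0\<close> by (simp add: field_simps)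
  qed
  then show "(INF q\<in>C. q (c *\<^sub>R x)) \<le> c * (INF q\<in>C. q x)" using \<open>c > 0\<close> by (simp add: field_simps)
qed

text \<open>Zorn's lemma for the reversed pointwise order. A nonempty chain is bounded below at
  \<open>x\<close> by \<open>- p (- x)\<close>, so its pointwise infimum exists and is again
  sublinear.\<close>

lemma minimal_sublinear_exists:
  assumes "sublinear p"
  obtains m where "sublinear m" "m \<le> p" "\<And>q. sublinear q \<Longrightarrow> q \<le> m \<Longrightarrow> q = m"
proof -
  define A where "A = {q. sublinear q \<and> q \<le> p}"
  have "\<exists>m\<in>A. \<forall>q\<in>A. q \<le> m \<longrightarrow> q = m"
  proof (rule predicate_Zorn)
    show "partial_order_on A (relation_of (\<lambda>a b. b \<le> a) A)"
      by (rule partial_order_on_relation_ofI) auto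
  next
    fix C assume C: "C \<in> Chains (relation_of (\<lambda>a b. b \<le> a) A)"
    then have CA: "C \<subseteq> A" and chain: "\<And>q r. q \<in> C \<Longrightarrow> r \<in> C \<Longrightarrow> q \<le> r \<or> r \<le> q"
      unfolding Chains_def relation_of_def by blast+
    show "\<exists>u\<in>A. \<forall>a\<in>C. u \<le> a"
    proof (cases "C = {}")
      case True
      then show ?thesis using assms unfolding A_def by auto
    next
      case False
      have bdd: "bdd_below ((\<lambda>q. q x) ` C)" for x
      proof (rule bdd_belowI2)
        fix q assume "q \<in> C"
        then have "sublinear q" "q (- x) \<le> p (- x)" using CA unfolding A_def le_fun_def by blast+
        then show "- p (- x) \<le> q x" using sublinear_ge[of q x] by linarith
      qed
      let ?u = "\<lambda>x. INF q\<in>C. q x"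
      have low: "?u \<le> q" if "q \<in> C" for q
        using that bdd by (auto simp: le_fun_def intro!: cINF_lower)
      obtain q where "q \<in> C" using False by blast
      then have "?u \<le> p" using low[of q] CA unfolding A_def
        by (metis (no_types, lifting) dual_order.trans mem_Collect_eq subsetD)
      moreover have "sublinear ?u"
        using CA chain bdd False unfolding A_def by (intro sublinear_INF_chain) auto
      ultimately show ?thesis using low unfolding A_def by blast
    qed
  qed
  then obtain m where "m \<in> A" "\<And>q. q \<in> A \<Longrightarrow> q \<le> m \<Longrightarrow> q = m" by blast
  then show ?thesis using that unfolding A_def by (metis (no_types, lifting) dual_order.trans mem_Collect_eq)
qed

lemma minimal_sublinear_linear:
  assumes m: "sublinear m" and min: "\<And>q. sublinear q \<Longrightarrow> q \<le> m \<Longrightarrow> q = m"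
  shows "linear m"
proof -
  \<comment> \<open>Taking \<open>t = 0\<close> in the infimum puts the tilt below \<open>m\<close>,
    so minimality forces equality; \<open>t = 1\<close> then gives superadditivity.\<close>
  have "tilt m x = m" for x
    using tilt_le[OF m, of 0 x] by (intro min sublinear_tilt m) (simp add: le_fun_def)
  then have "m z + m x \<le> m (z + x)" for x z
    using tilt_le[OF m, of 1 x z] by simp
  then have add: "m (z + x) = m z + m x" for x z
    using sublinear_add[OF m] by (metis order_antisym)
  then have neg: "m (- x) = - m x" for x
    using add[of x "- x"] sublinear_zero[OF m] by simp
  have "m (c *\<^sub>R x) = c *\<^sub>R m x" for c x
  proof (cases "c \<ge> 0")
    case True then show ?thesis using sublinear_scaleR[OF m] by simp
  next
    case False
    then have "m ((- c) *\<^sub>R x) = (- c) * m x" using sublinear_scaleR[OF m, of "- c"] by simp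
    then show ?thesis using neg[of "c *\<^sub>R x"] by simp
  qed
  with add show ?thesis by (intro linearI) auto
qed

text \<open>The minimal functional is taken below \<open>tilt p x0\<close> instead of
  \<open>p\<close>: since \<open>tilt p x0 (- x0) \<le> - p x0\<close>, linearity forces it to
  attain \<open>p x0\<close> at \<open>x0\<close>.\<close>

theorem hahn_banach_sublinear:
  assumes "sublinear p"
  obtains \<Lambda> where "linear \<Lambda>" "\<Lambda> \<le> p" "\<Lambda> x0 = p x0"
proof -
  obtain m where m: "sublinear m" "m \<le> tilt p x0" "\<And>q. sublinear q \<Longrightarrow> q \<le> m \<Longrightarrow> q = m"
    using minimal_sublinear_exists[OF sublinear_tilt[OF assms]] by metis
  have lin: "linear m" using m by (intro minimal_sublinear_linear)
  have "tilt p x0 \<le> p" using tilt_le[OF assms, of 0 x0] by (simp add: le_fun_def)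
  with m have le: "m \<le> p" by (metis order_trans)
  have "m (- x0) \<le> tilt p x0 (- x0)" using m(2) by (simp add: le_fun_def)
  also have "\<dots> \<le> - p x0" using tilt_le[OF assms, of 1 x0 "- x0"] sublinear_zero[OF assms] by simp
  finally have "p x0 \<le> m x0" using linear_neg[OF lin] by simp
  then show ?thesis using that[OF lin le] le by (auto simp: le_fun_def intro: antisym)
qed

section \<open>Functionals attaining the distance to a subspace\<close>

lemma sublinear_infdist:
  fixes L :: "'a::real_normed_vector set"
  assumes "subspace L" shows "sublinear (\<lambda>u. infdist u L)"
  unfolding sublinear_def
proof (intro conjI allI impI)
  have ne: "L \<noteq> {}" using subspace_0[OF assms] by blast
  fix u v
  have le: "infdist (u + v) L \<le> dist u l + dist v k" if "l \<in> L" "k \<in> L" for l k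
  proof -
    have "infdist (u + v) L \<le> dist (u + v) (l + k)"
      using subspace_add[OF assms] that by (intro infdist_le) auto
    also have "\<dots> \<le> dist u l + dist v k" by (rule dist_triangle_add)
    finally show ?thesis .
  qed
  have "infdist (u + v) L - dist v k \<le> infdist u L" if "k \<in> L" for k
    unfolding infdist_notempty[OF ne, of u]
    using ne le that by (intro cINF_greatest) (auto simp: algebra_simps)
  then have "infdist (u + v) L - infdist u L \<le> infdist v L"
    unfolding infdist_notempty[OF ne, of v]
    using ne by (intro cINF_greatest) (auto simp: algebra_simps)
  then show "infdist (u + v) L \<le> infdist u L + infdist v L" by simp
next
  have ne: "L \<noteq> {}" using subspace_0[OF assms] by blast
  fix c :: real and u assume "c > 0"
  have "infdist (c *\<^sub>R u) L / c \<le> infdist u L"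
    unfolding infdist_notempty[OF ne, of u]
  proof (rule cINF_greatest[OF ne])
    fix l assume "l \<in> L"
    then have "infdist (c *\<^sub>R u) L \<le> dist (c *\<^sub>R u) (c *\<^sub>R l)"
      using subspace_scale[OF assms] by (intro infdist_le) auto
    also have "\<dots> = c * dist u l"
      using \<open>c > 0\<close> by (simp add: dist_norm flip: scaleR_diff_right)
    finally show "infdist (c *\<^sub>R u) L / c \<le> dist u l" using \<open>c > 0\<close> by (simp add: field_simps)
  qed
  then show "infdist (c *\<^sub>R u) L \<le> c * infdist u L" using \<open>c > 0\<close> by (simp add: field_simps)
qed

text \<open>The distance to \<open>L\<close> vanishes on \<open>L\<close> and is at most the norm,
  since \<open>0 \<in> L\<close>; a linear functional below it inherits both properties.\<close>

lemma hahn_banach_infdist: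
  fixes L :: "'a::real_normed_vector set"
  assumes "subspace L"
  obtains \<Lambda> :: "'a \<Rightarrow> real" where "linear \<Lambda>" "\<And>u. \<bar>\<Lambda> u\<bar> \<le> norm u" "\<And>l. l \<in> L \<Longrightarrow> \<Lambda> l = 0"
    "\<Lambda> u0 = infdist u0 L"
proof -
  obtain \<Lambda> where lin: "linear \<Lambda>" and le: "\<Lambda> \<le> (\<lambda>u. infdist u L)" and eq: "\<Lambda> u0 = infdist u0 L"
    using hahn_banach_sublinear[OF sublinear_infdist[OF assms]] by blast
  have abs: "\<bar>\<Lambda> u\<bar> \<le> max (infdist u L) (infdist (- u) L)" for u
    using le linear_neg[OF lin, of u] unfolding le_fun_def by (smt (verit))
  have inf_le: "infdist u L \<le> norm u" for u
    using infdist_le[OF subspace_0[OF assms], of u] by simp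
  have 1: "\<bar>\<Lambda> u\<bar> \<le> norm u" for u
    using abs[of u] inf_le[of u] inf_le[of "- u"] by simp
  have 2: "\<Lambda> l = 0" if "l \<in> L" for l
    using abs[of l] that subspace_neg[OF assms that] by simp
  show ?thesis using that[OF lin 1 2 eq] .
qed

subsection \<open>Finite-dimensional subspaces of normed spaces\<close>

text \<open>A convergent sequence is bounded, so it stays in one ball, where the compact slice of
  \<open>S\<close> is closed.\<close>

lemma closed_if_compact_Int_cball:
  fixes S :: "'a::real_normed_vector set"
  assumes "\<And>r. compact (S \<inter> cball 0 r)" shows "closed S"
unfolding closed_sequential_limits
proof (intro allI impI, elim conjE)
  fix f l assume f: "\<forall>n. f n \<in> S" "f \<longlonglongrightarrow> l"
  then obtain r where r: "\<And>n. norm (f n) \<le> r"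
    using Bseq_eq_bounded convergent_imp_Bseq convergentI by (metis BseqE)
  then have "\<And>n. f n \<in> S \<inter> cball 0 r" using f by simp
  then have "l \<in> S \<inter> cball 0 r"
    using closed_sequentially[OF compact_imp_closed[OF assms]] f(2) by blast
  then show "l \<in> S" by simp
qed

text \<open>For \<open>t \<noteq> 0\<close>, the right-hand side is \<open>\<bar>t\<bar>\<close>
  times the distance from \<open>b\<close> to the point \<open>- s / t\<close> of \<open>S\<close>.
  This controls the coordinate along a new spanning vector.\<close>

lemma abs_coeff_mult_infdist_le:
  assumes "subspace S" "s \<in> S"
  shows "\<bar>t\<bar> * infdist b S \<le> norm (s + t *\<^sub>R b)"
proof (cases "t = 0")
  case False
  have "infdist b S \<le> dist b (- inverse t *\<^sub>R s)"
    using subspace_scale[OF assms] by (rule infdist_le)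
  then have "\<bar>t\<bar> * infdist b S \<le> \<bar>t\<bar> * norm (b + inverse t *\<^sub>R s)"
    by (intro mult_left_mono) (auto simp: dist_norm)
  also have "\<dots> = norm (t *\<^sub>R (b + inverse t *\<^sub>R s))" by simp
  also have "t *\<^sub>R (b + inverse t *\<^sub>R s) = s + t *\<^sub>R b" using False by (simp add: algebra_simps)
  finally show ?thesis .
qed simp

lemma compact_span_Int_cball:
  fixes B :: "'a::real_normed_vector set"
  assumes "finite B" shows "compact (span B \<inter> cball 0 r)"
  using assms
proof (induction B arbitrary: r rule: finite_induct)
  case empty
  have "span {} \<inter> cball (0::'a) r \<subseteq> {0}" by simp
  then show ?case using finite_imp_compact finite_subset by (metis finite.emptyI finite_insert)
next
  case (insert b B)
  show ?case
  proof (cases "b \<in> span B")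
    case True
    then show ?thesis using insert.IH by (simp add: span_redundant)
  next
    case False
    have cl: "closed (span B)" using insert.IH by (rule closed_if_compact_Int_cball)
    define d where "d = infdist b (span B)"
    have d: "d > 0" unfolding d_def
      using infdist_pos_not_in_closed[OF cl _ False] span_zero by blast
    \<comment> \<open>The coefficient of \<open>b\<close> is at most \<open>r / d\<close>, and
      \<open>R\<close> then bounds the part in \<open>span B\<close>. The radius changes, so the
      induction runs over all \<open>r\<close>.\<close>
    define R where "R = r + r / d * norm b"
    define F where "F = (\<lambda>(s, t). s + t *\<^sub>R b)"
    define K where "K = (span B \<inter> cball 0 R) \<times> {-(r/d)..r/d}"
    have "span (insert b B) \<inter> cball 0 r = F ` K \<inter> cball 0 r"
    proof (intro equalityI subsetI)
      fix x assume x: "x \<in> span (insert b B) \<inter> cball 0 r"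
      then obtain t where t: "x - t *\<^sub>R b \<in> span B" by (auto simp: span_insert)
      have "\<bar>t\<bar> * d \<le> norm x"
        using abs_coeff_mult_infdist_le[OF subspace_span t, of t b] by (simp add: d_def)
      then have tr: "\<bar>t\<bar> \<le> r / d" using d x by (simp add: field_simps)
      have "norm (x - t *\<^sub>R b) \<le> norm x + \<bar>t\<bar> * norm b"
        using norm_triangle_ineq4[of x "t *\<^sub>R b"] by simp
      also have "\<dots> \<le> R" unfolding R_def using x tr by (intro add_mono mult_right_mono) auto
      finally have "(x - t *\<^sub>R b, t) \<in> K" using t tr by (auto simp: K_def)
      then have "F (x - t *\<^sub>R b, t) \<in> F ` K" by (rule imageI)
      then show "x \<in> F ` K \<inter> cball 0 r" using x by (simp add: F_def)
    next
      fix x assume "x \<in> F ` K \<inter> cball 0 r"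
      then obtain s t where "x = s + t *\<^sub>R b" "s \<in> span B" "x \<in> cball 0 r"
        by (auto simp: F_def K_def)
      then show "x \<in> span (insert b B) \<inter> cball 0 r"
        by (auto simp: span_insert intro!: exI[of _ t])
    qed
    moreover have "continuous_on K F"
      unfolding F_def case_prod_unfold by (intro continuous_intros)
    moreover have "compact K" unfolding K_def using insert.IH by (intro compact_Times compact_Icc)
    ultimately show ?thesis
      by (metis closed_cball compact_Int_closed compact_continuous_image)
  qed
qed

lemma closed_span_finite:
  fixes B :: "'a::real_normed_vector set"
  shows "finite B \<Longrightarrow> closed (span B)"
  by (intro closed_if_compact_Int_cball compact_span_Int_cball)

text \<open>By induction: the coefficient of a new vector \<open>b\<close> is at most
  \<open>norm x / d\<close>, where \<open>d\<close> is the distance from \<open>b\<close> to the old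
  span, positive because that span is closed.\<close>

lemma linear_bounded_on_span:
  fixes T :: "'a::real_normed_vector \<Rightarrow> 'b::real_normed_vector"
  assumes T: "linear T" and "finite B"
  shows "\<exists>M\<ge>0. \<forall>x\<in>span B. norm (T x) \<le> M * norm x"
  using \<open>finite B\<close>
proof (induction B rule: finite_induct)
  case empty
  then show ?case using linear_0[OF T] by auto
next
  case (insert b B)
  then obtain M where M: "M \<ge> 0" "\<And>x. x \<in> span B \<Longrightarrow> norm (T x) \<le> M * norm x" by blast
  show ?case
  proof (cases "b \<in> span B")
    case True
    then show ?thesis using insert.IH by (simp add: span_redundant)
  next
    case False
    define d where "d = infdist b (span B)"
    have d: "d > 0" unfolding d_def
      using infdist_pos_not_in_closed[OF closed_span_finite[OF insert(1)] _ False] span_zero by blast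
    define m where "m = M * norm b + norm (T b)"
    have m: "m \<ge> 0" using M(1) by (simp add: m_def)
    have "norm (T x) \<le> (M + m / d) * norm x" if "x \<in> span (insert b B)" for x
    proof -
      obtain t where t: "x - t *\<^sub>R b \<in> span B" using \<open>x \<in> span (insert b B)\<close> by (auto simp: span_insert)
      have td: "\<bar>t\<bar> * d \<le> norm x"
        using abs_coeff_mult_infdist_le[OF subspace_span t, of t b] by (simp add: d_def)
      have "T x = T (x - t *\<^sub>R b) + t *\<^sub>R T b"
        using T by (simp add: linear_diff linear_scale)
      then have "norm (T x) \<le> norm (T (x - t *\<^sub>R b)) + \<bar>t\<bar> * norm (T b)"
        using norm_triangle_ineq[of "T (x - t *\<^sub>R b)" "t *\<^sub>R T b"] by simp
      also have "\<dots> \<le> M * norm (x - t *\<^sub>R b) + \<bar>t\<bar> * norm (T b)" using M(2)[OF t] by simp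
      also have "\<dots> \<le> M * (norm x + \<bar>t\<bar> * norm b) + \<bar>t\<bar> * norm (T b)"
        using M(1) norm_triangle_ineq4[of x "t *\<^sub>R b"] by (intro add_mono mult_left_mono) auto
      also have "\<dots> = M * norm x + \<bar>t\<bar> * m" by (simp add: m_def algebra_simps)
      also have "\<dots> \<le> M * norm x + (norm x / d) * m"
        using td d m by (intro add_mono mult_right_mono) (auto simp: field_simps)
      finally show ?thesis by (simp add: algebra_simps)
    qed
    moreover have "M + m / d \<ge> 0" using M(1) m d by simp
    ultimately show ?thesis by blast
  qed
qed

text \<open>A point of the unit ball of the span is a net point plus \<open>\<delta>\<close> times
  another point of that ball, so the supremum \<open>M\<close> satisfies
  \<open>M \<le> c + \<delta> * M\<close>. Solving for \<open>M\<close> requires it to be finite,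
  hence the prior bound \<open>C\<close>.\<close>

lemma linear_bound_from_net:
  fixes T :: "'a::real_normed_vector \<Rightarrow> 'b::real_normed_vector"
  assumes T: "linear T" and "finite B" and \<delta>: "0 < \<delta>" "\<delta> < 1"
    and N: "N \<subseteq> span B" "span B \<inter> cball 0 1 \<subseteq> (\<Union>n\<in>N. ball n \<delta>)"
    and c: "\<And>n. n \<in> N \<Longrightarrow> norm (T n) \<le> c"
    and x: "x \<in> span B"
  shows "norm (T x) \<le> c / (1 - \<delta>) * norm x"
proof -
  let ?K = "span B \<inter> cball 0 1"
  define M where "M = (SUP e\<in>?K. norm (T e))"
  obtain C where C: "C \<ge> 0" "\<And>x. x \<in> span B \<Longrightarrow> norm (T x) \<le> C * norm x"
    using linear_bounded_on_span[OF T \<open>finite B\<close>] by blast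
  have "norm (T e) \<le> C" if "e \<in> ?K" for e
    using C(2)[of e] that mult_left_mono[OF _ C(1), of "norm e" 1] by simp
  then have bdd: "bdd_above ((\<lambda>e. norm (T e)) ` ?K)" by (rule bdd_aboveI2)
  have M_ge: "norm (T e) \<le> M" if "e \<in> ?K" for e
    unfolding M_def using bdd that by (intro cSUP_upper)
  have "M \<le> c + \<delta> * M"
    unfolding M_def
  proof (rule cSUP_least)
    show "?K \<noteq> {}" using span_zero[of B] by force
    fix e assume e: "e \<in> ?K"
    then obtain n where n: "n \<in> N" "dist n e < \<delta>" using N(2) by auto
    define k where "k = inverse \<delta> *\<^sub>R (e - n)"
    have "k \<in> span B" unfolding k_def using e n N(1) by (intro span_scale span_diff) auto
    moreover have "norm k \<le> 1"
      using n(2) \<delta>(1) by (simp add: k_def dist_norm norm_minus_commute pos_divide_le_eq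
          inverse_eq_divide del: scaleR_right_diff_distrib)
    ultimately have "k \<in> ?K" by simp
    have "e = n + \<delta> *\<^sub>R k" using \<delta> by (simp add: k_def)
    then have "T e = T n + \<delta> *\<^sub>R T k" using T by (simp add: linear_add linear_scale)
    then have "norm (T e) \<le> norm (T n) + \<delta> * norm (T k)"
      using norm_triangle_ineq[of "T n" "\<delta> *\<^sub>R T k"] \<delta> by simp
    also have "\<dots> \<le> c + \<delta> * M"
      using c[OF n(1)] M_ge[OF \<open>k \<in> ?K\<close>] \<delta> by (intro add_mono mult_left_mono) auto
    finally show "norm (T e) \<le> c + \<delta> * (SUP e\<in>?K. norm (T e))" by (simp add: M_def)
  qed
  then have M_le: "M \<le> c / (1 - \<delta>)" using \<delta> by (simp add: field_simps)
  show ?thesis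
  proof (cases "x = 0")
    case True
    then show ?thesis using linear_0[OF T] by simp
  next
    case False
    have "inverse (norm x) *\<^sub>R x \<in> ?K" using x False by (auto intro: span_scale)
    then have "norm (T (inverse (norm x) *\<^sub>R x)) \<le> c / (1 - \<delta>)" using M_ge M_le by (meson order_trans)
    then show ?thesis using False T by (simp add: linear_scale field_simps)
  qed
qed

subsection \<open>Local reflexivity\<close>

lemma canon_emb_apply [simp]: "blinfun_apply (canon_emb y) g = blinfun_apply g y"
  unfolding canon_emb_def by (simp add: bounded_linear_Blinfun_apply blinfun.bounded_linear_left)

lemma linear_canon_emb: "linear canon_emb"
  by (intro linearI blinfun_eqI) (simp_all add: blinfun.bilinear_simps)

lemma norm_canon_emb_le: "norm (canon_emb y) \<le> norm y"
  by (rule norm_blinfun_bound) (simp_all, metis norm_blinfun mult.commute real_norm_def)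

text \<open>Hahn-Banach for the zero subspace gives a functional bounded by the norm whose value at
  \<open>y\<close> is \<open>norm y\<close>.\<close>

lemma inj_canon_emb: "inj (canon_emb :: 'a::real_normed_vector \<Rightarrow> _)"
  unfolding linear_injective_0[OF linear_canon_emb]
proof (intro allI impI)
  fix y :: 'a assume 0: "canon_emb y = 0"
  obtain \<Lambda> :: "'a \<Rightarrow> real" where \<Lambda>: "linear \<Lambda>" "\<And>u. \<bar>\<Lambda> u\<bar> \<le> norm u" "\<Lambda> y = infdist y {0}"
    using hahn_banach_infdist[OF subspace_single_0] by metis
  then have bl: "bounded_linear \<Lambda>"
    by (intro bounded_linear_intro[where K=1]) (auto simp: linear_add linear_scale)
  have "blinfun_apply (canon_emb y) (Blinfun \<Lambda>) = norm y"
    using \<Lambda>(3) bl by (simp add: bounded_linear_Blinfun_apply)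
  with 0 show "y = 0" by simp
qed

text \<open>The hypothesis says that the algebraic tensor \<open>\<Sum>i. z i \<otimes> g i\<close> vanishes.\<close>
lemma sum_bilinear_eq_0:
  fixes z :: "'i \<Rightarrow> 'a::real_vector" and g :: "'i \<Rightarrow> 'b::real_vector"
    and \<beta> :: "'a \<Rightarrow> 'b \<Rightarrow> 'c::real_vector"
  assumes "finite I"
    and 0: "\<And>\<phi>::'a \<Rightarrow> real. linear \<phi> \<Longrightarrow> (\<Sum>i\<in>I. \<phi> (z i) *\<^sub>R g i) = 0"
    and \<beta>1: "\<And>b. linear (\<lambda>a. \<beta> a b)" and \<beta>2: "\<And>a. linear (\<beta> a)"
  shows "(\<Sum>i\<in>I. \<beta> (z i) (g i)) = 0"
proof -
  \<comment> \<open>Expanding the \<open>z i\<close> in a Hamel basis reduces the claim to the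
    coordinate functionals \<open>\<phi> b\<close>; only the \<open>b\<close> in the finite set
    \<open>S\<close> contribute.\<close>
  obtain B :: "'a set" where B: "independent B" "UNIV \<subseteq> span B"
    using maximal_independent_subset[of UNIV] by metis
  define \<phi> where "\<phi> b a = representation B a b" for a b
  have lin: "linear (\<phi> b)" for b
    using B unfolding \<phi>_def
    by (intro linearI) (simp_all add: real_vector.representation_add real_vector.representation_scale subset_eq)
  define S where "S = (\<Union>i\<in>I. {b. \<phi> b (z i) \<noteq> 0})"
  have S: "finite S" using \<open>finite I\<close>
    unfolding S_def \<phi>_def by (simp add: real_vector.finite_representation)
  have z: "z i = (\<Sum>b\<in>S. \<phi> b (z i) *\<^sub>R b)" if "i \<in> I" for i
  proof -
    have "z i = (\<Sum>b | \<phi> b (z i) \<noteq> 0. \<phi> b (z i) *\<^sub>R b)"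
      unfolding \<phi>_def using B by (intro real_vector.sum_nonzero_representation_eq[symmetric]) auto
    also have "\<dots> = (\<Sum>b\<in>S. \<phi> b (z i) *\<^sub>R b)"
      using S that by (intro sum.mono_neutral_left) (auto simp: S_def)
    finally show ?thesis .
  qed
  have "\<beta> (z i) (g i) = (\<Sum>b\<in>S. \<beta> b (\<phi> b (z i) *\<^sub>R g i))" if "i \<in> I" for i
    by (subst z[OF that]) (simp add: linear_sum[OF \<beta>1] linear_scale[OF \<beta>1] linear_scale[OF \<beta>2])
  then have "(\<Sum>i\<in>I. \<beta> (z i) (g i)) = (\<Sum>i\<in>I. \<Sum>b\<in>S. \<beta> b (\<phi> b (z i) *\<^sub>R g i))" by simp
  also have "\<dots> = (\<Sum>b\<in>S. \<beta> b (\<Sum>i\<in>I. \<phi> b (z i) *\<^sub>R g i))"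
    by (subst sum.swap) (simp add: linear_sum[OF \<beta>2])
  also have "\<dots> = 0" using 0[OF lin] linear_0[OF \<beta>2] by simp
  finally show ?thesis .
qed

text \<open>The power \<open>'a ^ m\<close> with the maximum norm, where \<open>m\<close> may depend on the proof context, is
  realised inside the bounded functions on the (discrete) natural numbers.\<close>
definition tuple :: "nat \<Rightarrow> (nat \<Rightarrow> 'a::real_normed_vector) \<Rightarrow> nat \<Rightarrow>\<^sub>C 'a" where
  "tuple m u = Bcontfun (\<lambda>r. if r < m then u r else 0)"

lemma apply_tuple [simp]: "apply_bcontfun (tuple m u) r = (if r < m then u r else 0)"
proof -
  have "(\<lambda>r. if r < m then u r else 0) \<in> bcontfun"
  proof (rule bcontfun_normI)
    fix r
    show "norm (if r < m then u r else 0) \<le> (\<Sum>s<m. norm (u s))"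
      by (auto intro: member_le_sum sum_nonneg)
  qed simp
  then show ?thesis unfolding tuple_def by (simp add: Bcontfun_inverse)
qed

lemma tuple_add: "tuple m (\<lambda>r. u r + v r) = tuple m u + tuple m v"
  by (rule bcontfun_eqI) simp

lemma tuple_scaleR: "tuple m (\<lambda>r. c *\<^sub>R u r) = c *\<^sub>R tuple m u"
  by (rule bcontfun_eqI) simp

lemma apply_bcontfun_sum: "apply_bcontfun (sum f A) x = (\<Sum>a\<in>A. apply_bcontfun (f a) x)"
  by (induction A rule: infinite_finite_induct) auto

lemma norm_tuple_le: "(\<And>r. r < m \<Longrightarrow> norm (u r) \<le> c) \<Longrightarrow> c \<ge> 0 \<Longrightarrow> norm (tuple m u) \<le> c"
  by (rule norm_bound) simp

text \<open>The dual of the maximum norm on a power is the sum of the dual norms. Norms need not be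
  attained, so \<open>\<Lambda>\<close> is tested on a tuple of nearly norming vectors.\<close>

lemma linear_functional_tuple:
  fixes \<Lambda> :: "(nat \<Rightarrow>\<^sub>C 'a::real_normed_vector) \<Rightarrow> real"
  assumes lin: "linear \<Lambda>" and le: "\<And>u. \<bar>\<Lambda> u\<bar> \<le> norm u"
  obtains g :: "nat \<Rightarrow> 'a \<Rightarrow>\<^sub>L real" where "\<And>u. \<Lambda> (tuple m u) = (\<Sum>r<m. g r (u r))"
    "(\<Sum>r<m. norm (g r)) \<le> 1"
proof -
  define single where "single r y = tuple m (\<lambda>s. if s = r then y else (0::'a))" for r y
  have s_add: "single r (x + y) = single r x + single r y" for r x y
    unfolding single_def by (subst tuple_add[symmetric]) (rule arg_cong[where f = "tuple m"], auto)
  have s_scale: "single r (c *\<^sub>R x) = c *\<^sub>R single r x" for r x c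
    unfolding single_def by (subst tuple_scaleR[symmetric]) (rule arg_cong[where f = "tuple m"], auto)
  have "norm (single r y) \<le> norm y" for r y
    unfolding single_def by (rule norm_tuple_le) auto
  then have bl: "bounded_linear (\<lambda>y. \<Lambda> (single r y))" for r
    using lin le by (intro bounded_linear_intro[where K=1])
      (auto simp: s_add s_scale linear_add linear_scale intro: order_trans)
  define g where "g r = Blinfun (\<lambda>y. \<Lambda> (single r y))" for r
  have g: "g r y = \<Lambda> (single r y)" for r y
    unfolding g_def using bl by (simp add: bounded_linear_Blinfun_apply)
  have rep: "\<Lambda> (tuple m u) = (\<Sum>r<m. g r (u r))" for u
  proof -
    have "tuple m u = (\<Sum>r<m. single r (u r))"
      by (rule bcontfun_eqI) (auto simp: apply_bcontfun_sum single_def)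
    then show ?thesis using lin by (simp add: g linear_sum)
  qed
  have "(\<Sum>r<m. norm (g r)) \<le> 1"
  proof (rule field_le_epsilon)
    fix e :: real assume "e > 0"
    \<comment> \<open>The loss \<open>\<eta>\<close> occurs \<open>m\<close> times; the added 1
      avoids division by zero for \<open>m = 0\<close>.\<close>
    define \<eta> where "\<eta> = e / (real m + 1)"
    have \<eta>: "\<eta> > 0" using \<open>e > 0\<close> by (simp add: \<eta>_def)
    have "\<exists>y. norm y \<le> 1 \<and> norm (g r) - \<eta> \<le> g r y" for r
    proof (rule ccontr)
      assume "\<not> ?thesis"
      then have lt: "norm y \<le> 1 \<Longrightarrow> g r y < norm (g r) - \<eta>" for y by (meson not_le)
      have nn: "norm (g r) - \<eta> \<ge> 0" using lt[of 0] by simp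
      have "norm (g r) \<le> norm (g r) - \<eta>"
      proof (rule norm_blinfun_bound[OF nn])
        fix x
        show "norm (g r x) \<le> (norm (g r) - \<eta>) * norm x"
        proof (cases "x = 0")
          case False
          have "g r (inverse (norm x) *\<^sub>R x) < norm (g r) - \<eta>"
            "g r (inverse (norm x) *\<^sub>R (- x)) < norm (g r) - \<eta>"
            using False by (auto intro!: lt)
          then show ?thesis using False
            by (simp add: blinfun.bilinear_simps field_simps abs_le_iff)
        qed simp
      qed
      then show False using \<eta> by simp
    qed
    then obtain y where y: "\<And>r. norm (y r) \<le> 1" "\<And>r. norm (g r) - \<eta> \<le> g r (y r)" by metis
    have "(\<Sum>r<m. norm (g r)) - m * \<eta> = (\<Sum>r<m. norm (g r) - \<eta>)" by (simp add: sum_subtractf)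
    also have "\<dots> \<le> \<Lambda> (tuple m y)" unfolding rep by (intro sum_mono y)
    also have "\<dots> \<le> norm (tuple m y)" using le[of "tuple m y"] by simp
    also have "\<dots> \<le> 1" by (intro norm_tuple_le y) simp
    finally have "(\<Sum>r<m. norm (g r)) \<le> 1 + m * \<eta>" by simp
    also have "m * \<eta> \<le> e" using \<open>e > 0\<close> by (simp add: \<eta>_def field_simps)
    finally show "(\<Sum>r<m. norm (g r)) \<le> 1 + e" by simp
  qed
  with rep show ?thesis by (rule that)
qed

lemma local_reflexivity_finite:
  fixes N :: "(('y::real_normed_vector \<Rightarrow>\<^sub>L real) \<Rightarrow>\<^sub>L real) set"
  assumes "finite N" and N1: "\<And>n. n \<in> N \<Longrightarrow> norm n \<le> 1" and "\<epsilon> > 0"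
  obtains T :: "(('y \<Rightarrow>\<^sub>L real) \<Rightarrow>\<^sub>L real) \<Rightarrow> 'y"
    where "linear T" "\<And>y. T (canon_emb y) = y" "\<And>n. n \<in> N \<Longrightarrow> norm (T n) \<le> 1 + \<epsilon>"
proof -
  \<comment> \<open>\<open>T0\<close> comes from linear algebra alone, with no bound on its
    norm.\<close>
  obtain T0 :: "(('y \<Rightarrow>\<^sub>L real) \<Rightarrow>\<^sub>L real) \<Rightarrow> 'y" where T0: "linear T0" "T0 \<circ> canon_emb = id"
    using real_vector.linear_injective_left_inverse linear_canon_emb inj_canon_emb
    by (metis linear_injective_left_inverse)
  have T0j: "T0 (canon_emb y) = y" for y using T0(2) by (simp add: fun_eq_iff)
  obtain m :: nat and e where e: "N = e ` {..<m}"
    using finite_imp_nat_seg_image_inj_on[OF \<open>finite N\<close>] by (auto simp: lessThan_def)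
  \<comment> \<open>\<open>LT\<close> holds the differences of two linear left inverses, so the
    tuples of all left inverses form the affine space \<open>u0 + L\<close>. It remains to show that
    \<open>u0\<close> has distance at most 1 from \<open>L\<close>.\<close>
  define LT where "LT = {T :: (('y \<Rightarrow>\<^sub>L real) \<Rightarrow>\<^sub>L real) \<Rightarrow> 'y. linear T \<and> (\<forall>y. T (canon_emb y) = 0)}"
  define L where "L = (\<lambda>T. tuple m (\<lambda>r. T (e r))) ` LT"
  have "subspace L"
  proof (rule subspaceI)
    have "(\<lambda>x. 0) \<in> LT" by (simp add: LT_def linear_iff)
    then have "tuple m (\<lambda>r. 0) \<in> L" unfolding L_def by (rule rev_image_eqI) simp
    moreover have "tuple m (\<lambda>r. 0 :: 'y) = 0" by (rule bcontfun_eqI) simp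
    ultimately show "0 \<in> L" by simp
  next
    fix a b assume "a \<in> L" "b \<in> L"
    then obtain S T where "S \<in> LT" "T \<in> LT" "a = tuple m (\<lambda>r. S (e r))" "b = tuple m (\<lambda>r. T (e r))"
      by (auto simp: L_def)
    then have "(\<lambda>x. S x + T x) \<in> LT" "a + b = tuple m (\<lambda>r. S (e r) + T (e r))"
      by (auto simp: LT_def tuple_add intro: linear_compose_add)
    then show "a + b \<in> L" unfolding L_def by (intro rev_image_eqI)
  next
    fix c :: real and a assume "a \<in> L"
    then obtain S where "S \<in> LT" "a = tuple m (\<lambda>r. S (e r))" by (auto simp: L_def)
    then have "(\<lambda>x. c *\<^sub>R S x) \<in> LT" "c *\<^sub>R a = tuple m (\<lambda>r. c *\<^sub>R S (e r))"
      by (auto simp: LT_def tuple_scaleR intro: linear_compose_scale_right)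
    then show "c *\<^sub>R a \<in> L" unfolding L_def by (intro rev_image_eqI)
  qed
  define u0 where "u0 = tuple m (\<lambda>r. T0 (e r))"
  obtain \<Lambda> :: "(nat \<Rightarrow>\<^sub>C 'y) \<Rightarrow> real" where \<Lambda>: "linear \<Lambda>" "\<And>u. \<bar>\<Lambda> u\<bar> \<le> norm u"
      "\<And>l. l \<in> L \<Longrightarrow> \<Lambda> l = 0" "\<Lambda> u0 = infdist u0 L"
    using hahn_banach_infdist[OF \<open>subspace L\<close>] by blast
  obtain g :: "nat \<Rightarrow> 'y \<Rightarrow>\<^sub>L real" where g: "\<And>u. \<Lambda> (tuple m u) = (\<Sum>r<m. g r (u r))"
    "(\<Sum>r<m. norm (g r)) \<le> 1"
    using linear_functional_tuple[OF \<Lambda>(1,2)] by blast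
  define z where "z r = e r - canon_emb (T0 (e r))" for r
  \<comment> \<open>\<open>\<Lambda>\<close> vanishes on tuples from rank-one maps in
    \<open>LT\<close>, so the tensor of the \<open>z r\<close> and \<open>g r\<close> is zero;
    pairing it by evaluation gives the claim.\<close>
  have "(\<Sum>r<m. z r (g r)) = 0"
  proof (rule sum_bilinear_eq_0[where \<beta> = blinfun_apply])
    fix \<phi> :: "(('y \<Rightarrow>\<^sub>L real) \<Rightarrow>\<^sub>L real) \<Rightarrow> real" assume \<phi>: "linear \<phi>"
    show "(\<Sum>r<m. \<phi> (z r) *\<^sub>R g r) = 0"
    proof (rule blinfun_eqI)
      fix y :: 'y
      \<comment> \<open>Since \<open>x - canon_emb (T0 x)\<close> is zero on the canonical image,
        this rank-one map lies in \<open>LT\<close>.\<close>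
      define T where "T x = \<phi> (x - canon_emb (T0 x)) *\<^sub>R y" for x
      have "linear T"
        by (intro linearI)
          (simp_all add: T_def linear_add[OF \<phi>] linear_add[OF T0(1)] linear_add[OF linear_canon_emb]
            linear_scale[OF \<phi>] linear_scale[OF T0(1)] linear_scale[OF linear_canon_emb]
            linear_diff[OF \<phi>] algebra_simps)
      then have "T \<in> LT" by (simp add: LT_def) (simp add: T_def T0j linear_0[OF \<phi>])
      then have "\<Lambda> (tuple m (\<lambda>r. T (e r))) = 0" by (intro \<Lambda>(3)) (simp add: L_def)
      then show "(\<Sum>r<m. \<phi> (z r) *\<^sub>R g r) y = blinfun_apply 0 y"
        by (simp add: g(1) T_def z_def blinfun.bilinear_simps)
    qed
  qed (simp_all add: bounded_linear.linear blinfun.bounded_linear_left blinfun.bounded_linear_right)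
  \<comment> \<open>\<open>\<Lambda> u0\<close> sums \<open>canon_emb (T0 (e r))\<close> evaluated
    at \<open>g r\<close>; replacing these by the \<open>e r\<close> changes the sum by the
    vanishing sum above. The norms of the \<open>e r\<close> can now be used.\<close>
  then have "\<Lambda> u0 = (\<Sum>r<m. e r (g r))"
    unfolding u0_def g(1) z_def by (simp add: blinfun.bilinear_simps sum_subtractf)
  also have "\<dots> \<le> (\<Sum>r<m. norm (g r))"
  proof (rule sum_mono)
    fix r assume "r \<in> {..<m}"
    then have "norm (e r) \<le> 1" using N1 e by blast
    then have "norm (e r) * norm (g r) \<le> 1 * norm (g r)" by (intro mult_right_mono) auto
    then show "e r (g r) \<le> norm (g r)" using norm_blinfun[of "e r" "g r"] by simp
  qed
  also have "\<dots> \<le> 1" by (rule g)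
  finally have "infdist u0 L < 1 + \<epsilon>" using \<Lambda>(4) \<open>\<epsilon> > 0\<close> by simp
  moreover have "L \<noteq> {}" using subspace_0[OF \<open>subspace L\<close>] by blast
  ultimately obtain l where l: "l \<in> L" "dist u0 l < 1 + \<epsilon>"
    by (metis infdist_notempty cINF_greatest not_le)
  then obtain T where T: "linear T" "\<And>y. T (canon_emb y) = 0" "l = tuple m (\<lambda>r. T (e r))"
    by (auto simp: L_def LT_def)
  show ?thesis
  proof (rule that[of "\<lambda>x. T0 x - T x"])
    show "linear (\<lambda>x. T0 x - T x)" using T0(1) T(1) by (rule linear_compose_sub)
    show "T0 (canon_emb y) - T (canon_emb y) = y" for y by (simp add: T0j T(2))
    fix n assume "n \<in> N"
    then obtain r where r: "r < m" "n = e r" using e by blast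
    have "norm (apply_bcontfun (u0 - l) r) \<le> norm (u0 - l)" by (rule norm_bounded)
    then show "norm (T0 n - T n) \<le> 1 + \<epsilon>" using r l by (simp add: u0_def T(3) dist_norm)
  qed
qed

theorem local_reflexivity:
  fixes A :: "(('y::real_normed_vector \<Rightarrow>\<^sub>L real) \<Rightarrow>\<^sub>L real) set"
  assumes "finite A" and "\<epsilon> > 0"
  obtains T :: "(('y \<Rightarrow>\<^sub>L real) \<Rightarrow>\<^sub>L real) \<Rightarrow> 'y"
    where "linear T" "\<And>y. T (canon_emb y) = y" "\<And>x. x \<in> span A \<Longrightarrow> norm (T x) \<le> (1 + \<epsilon>) * norm x"
proof -
  \<comment> \<open>Half of \<open>\<epsilon>\<close> is spent on the finite net;
    \<open>\<delta>\<close> is chosen so that passing from the net to the whole span gives exactly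
    \<open>1 + \<epsilon>\<close>.\<close>
  define \<delta> where "\<delta> = \<epsilon> / (2 + 2 * \<epsilon>)"
  have \<delta>: "0 < \<delta>" "\<delta> < 1" using \<open>\<epsilon> > 0\<close> by (auto simp: \<delta>_def field_simps)
  have eq: "(1 + \<epsilon> / 2) / (1 - \<delta>) = 1 + \<epsilon>"
    using \<open>\<epsilon> > 0\<close> by (simp add: \<delta>_def divide_simps) (simp add: algebra_simps)
  have "seq_compact (span A \<inter> cball 0 1)"
    using compact_span_Int_cball[OF \<open>finite A\<close>] by (rule compact_imp_seq_compact)
  then obtain N where N: "finite N" "N \<subseteq> span A \<inter> cball 0 1" "span A \<inter> cball 0 1 \<subseteq> (\<Union>n\<in>N. ball n \<delta>)"
    using seq_compact_imp_totally_bounded[rule_format, OF _ \<delta>(1)] by metis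
  obtain T :: "(('y \<Rightarrow>\<^sub>L real) \<Rightarrow>\<^sub>L real) \<Rightarrow> 'y"
    where T: "linear T" "\<And>y. T (canon_emb y) = y" "\<And>n. n \<in> N \<Longrightarrow> norm (T n) \<le> 1 + \<epsilon> / 2"
  proof (rule local_reflexivity_finite[OF N(1), of "\<epsilon> / 2"])
    show "norm n \<le> 1" if "n \<in> N" for n using that N(2) by auto
    show "\<epsilon> / 2 > 0" using \<open>\<epsilon> > 0\<close> by simp
  qed blast
  have "norm (T x) \<le> (1 + \<epsilon>) * norm x" if "x \<in> span A" for x
    using linear_bound_from_net[OF T(1) \<open>finite A\<close> \<delta> _ N(3) T(3) that] N(2) eq by auto
  with T show ?thesis using that by blast
qed

subsection \<open>Morphisms and their Lipschitz norms\<close>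

text \<open>A real \<open>Sup\<close> is informative only for sets bounded above, so facts about
  \<open>lip_norm\<close> start from some Lipschitz constant.\<close>

lemma lip_norm_bdd:
  assumes "C-lipschitz_on V f"
  shows "bdd_above (insert 0 {dist (f x) (f y) / dist x y | x y. x \<in> V \<and> y \<in> V \<and> x \<noteq> y})"
    and "lip_norm V f \<le> C"
proof -
  have "t \<le> C" if "t \<in> insert 0 {dist (f x) (f y) / dist x y | x y. x \<in> V \<and> y \<in> V \<and> x \<noteq> y}" for t
    using that lipschitz_on_nonneg[OF assms] lipschitz_onD[OF assms]
    by (auto simp: divide_le_eq mult.commute)
  then show "bdd_above (insert 0 {dist (f x) (f y) / dist x y | x y. x \<in> V \<and> y \<in> V \<and> x \<noteq> y})"
    and "lip_norm V f \<le> C"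
    unfolding lip_norm_def by (auto intro!: bdd_aboveI[of _ C] cSup_least simp del: insert_iff)
qed

lemma lip_norm_nonneg: "C-lipschitz_on V f \<Longrightarrow> lip_norm V f \<ge> 0"
  unfolding lip_norm_def by (rule cSup_upper[OF _ lip_norm_bdd(1)]) auto

lemma lipschitz_on_lip_norm:
  assumes "C-lipschitz_on V f" shows "(lip_norm V f)-lipschitz_on V f"
proof (rule lipschitz_onI)
  fix x y assume xy: "x \<in> V" "y \<in> V"
  show "dist (f x) (f y) \<le> lip_norm V f * dist x y"
  proof (cases "x = y")
    case False
    then have "dist (f x) (f y) / dist x y \<le> lip_norm V f"
      unfolding lip_norm_def using xy by (intro cSup_upper[OF _ lip_norm_bdd(1)[OF assms]]) auto
    then show ?thesis using False by (simp add: divide_le_eq)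
  qed simp
qed (rule lip_norm_nonneg[OF assms])

lemma lincomb_eq_sum:
  "length xs = length rs \<Longrightarrow> lincomb rs xs = (\<Sum>i<length rs. rs ! i *\<^sub>R xs ! i)"
  unfolding lincomb_def by (simp add: sum_list_sum_nth lessThan_atLeast0)

lemma linear_lincomb:
  assumes "linear T" "length xs = length rs"
  shows "T (lincomb rs xs) = lincomb rs (map T xs)"
  using assms by (simp add: lincomb_eq_sum linear_sum linear_scale)

lemma op_closed_subspace:
  fixes S :: "'a::real_vector set"
  assumes "subspace S"
  shows "op_closed Ops S"
  unfolding op_closed_def
proof (intro ballI allI impI)
  fix rs :: "real list" and xs :: "'a list" assume "length xs = length rs \<and> set xs \<subseteq> S"
  then show "lincomb rs xs \<in> S"
    by (auto simp: lincomb_eq_sum intro!: subspace_sum[OF assms] subspace_scale[OF assms])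
qed

lemma cat_morE:
  assumes "cat_mor Ops V W f"
  obtains "f ` V \<subseteq> W" "(lip_norm V f)-lipschitz_on V f"
    "\<And>rs xs. rs \<in> Ops \<Longrightarrow> length xs = length rs \<Longrightarrow> set xs \<subseteq> V \<Longrightarrow> f (lincomb rs xs) = lincomb rs (map f xs)"
  using assms lipschitz_on_lip_norm unfolding cat_mor_def by metis

text \<open>By Tychonoff the \<open>u i\<close> lie in a compact product of intervals and have a
  cluster point \<open>v\<close>. Refining the image of \<open>F\<close> by the neighbourhoods of
  \<open>v\<close> turns clustering into convergence at every point and keeps all eventual
  properties of the \<open>u i\<close>.\<close>

lemma pointwise_cluster_filter:
  fixes u :: "'i \<Rightarrow> 'a \<Rightarrow> real"
  assumes "F \<noteq> bot" and bound: "\<And>i a. \<bar>u i a\<bar> \<le> M a"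
  obtains v G where "G \<noteq> bot" "\<And>a. ((\<lambda>w. w a) \<longlongrightarrow> v a) G"
    "\<And>P. eventually (\<lambda>i. P (u i)) F \<Longrightarrow> eventually P G"
proof -
  let ?K = "PiE UNIV (\<lambda>a. {- M a..M a})"
  have "compactin euclidean ?K"
    unfolding euclidean_product_topology[symmetric] compactin_PiE by (simp add: compactin_euclidean_iff)
  then have "compact ?K" by (simp add: compactin_euclidean_iff)
  moreover have "filtermap u F \<noteq> bot" using assms(1) by (simp add: filtermap_bot_iff)
  moreover have "eventually (\<lambda>w. w \<in> ?K) (filtermap u F)"
    using bound by (auto simp: eventually_filtermap PiE_iff abs_le_iff minus_le_iff)
  ultimately obtain v where v: "inf (nhds v) (filtermap u F) \<noteq> bot"
    unfolding compact_filter by blast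
  show ?thesis
  proof (rule that[OF v])
    fix a
    have "((\<lambda>w. w a) \<longlongrightarrow> v a) (nhds v)"
      using continuous_on_product_coordinates[of a]
      unfolding continuous_on_def tendsto_at_iff_tendsto_nhds[of "\<lambda>w. w a" v, symmetric] by blast
    then show "((\<lambda>w. w a) \<longlongrightarrow> v a) (inf (nhds v) (filtermap u F))"
      by (rule tendsto_mono[rotated]) simp
  next
    fix P assume "eventually (\<lambda>i. P (u i)) F"
    then show "eventually P (inf (nhds v) (filtermap u F))"
      by (simp add: eventually_filtermap filter_leD[OF inf_le2])
  qed
qed

text \<open>The map is \<open>iota (T (h x))\<close> with \<open>T\<close> from local reflexivity:
  \<open>h\<close> sends the preimage into \<open>span A\<close>, where \<open>T\<close> has norm at
  most \<open>1 + \<epsilon>\<close>, and \<open>T\<close> undoes \<open>canon_emb\<close> on all of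
  \<open>Y\<close>, so points of \<open>Y\<close> are fixed.\<close>

lemma local_retraction_of_bidual_mor:
  fixes h :: "'x::real_normed_vector \<Rightarrow> ('y::real_normed_vector \<Rightarrow>\<^sub>L real) \<Rightarrow>\<^sub>L real"
  assumes iota_lin: "bounded_linear iota" and iota_isom: "\<And>y. norm (iota y) = norm y"
    and h: "cat_mor Ops UNIV UNIV h" "lip_norm UNIV h \<le> lam" "\<And>y. h (iota y) = canon_emb y"
    and "finite A" "\<epsilon> > 0"
  obtains \<phi> where "cat_mor Ops (h -` span A) (range iota) \<phi>"
    "lip_norm (h -` span A) \<phi> \<le> lam * (1 + \<epsilon>)"
    "\<And>e. e \<in> h -` span A \<inter> range iota \<Longrightarrow> \<phi> e = e"
proof -
  let ?V = "h -` span A"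
  obtain T :: "(('y \<Rightarrow>\<^sub>L real) \<Rightarrow>\<^sub>L real) \<Rightarrow> 'y" where T: "linear T" "\<And>y. T (canon_emb y) = y"
    "\<And>x. x \<in> span A \<Longrightarrow> norm (T x) \<le> (1 + \<epsilon>) * norm x"
    using local_reflexivity[OF \<open>finite A\<close> \<open>\<epsilon> > 0\<close>] by blast
  have lin: "linear (\<lambda>w. iota (T w))"
    using linear_compose[OF T(1) bounded_linear.linear[OF iota_lin]] by (simp add: o_def)
  obtain hL: "(lip_norm UNIV h)-lipschitz_on UNIV h"
    and hop: "\<And>rs xs. rs \<in> Ops \<Longrightarrow> length xs = length rs \<Longrightarrow> h (lincomb rs xs) = lincomb rs (map h xs)"
    using h(1) by (elim cat_morE) auto
  have hlam: "dist (h x) (h y) \<le> lam * dist x y" for x y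
    using lipschitz_onD[OF hL, of x y] h(2) mult_right_mono[OF h(2), of "dist x y"] by simp
  have lam: "lam \<ge> 0" using lipschitz_on_nonneg[OF hL] h(2) by simp
  define \<phi> where "\<phi> = (\<lambda>x. iota (T (h x)))"
  have lip: "(lam * (1 + \<epsilon>))-lipschitz_on ?V \<phi>"
  proof (rule lipschitz_onI)
    fix x y assume "x \<in> ?V" "y \<in> ?V"
    then have sp: "h x - h y \<in> span A" by (simp add: span_diff)
    have "dist (\<phi> x) (\<phi> y) = norm (T (h x - h y))"
      unfolding dist_norm \<phi>_def linear_diff[OF lin, symmetric] by (simp add: iota_isom)
    also have "\<dots> \<le> (1 + \<epsilon>) * norm (h x - h y)" using T(3) sp by blast
    also have "\<dots> \<le> (1 + \<epsilon>) * (lam * dist x y)"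
      using hlam[of x y] \<open>\<epsilon> > 0\<close> by (intro mult_left_mono) (auto simp: dist_norm)
    finally show "dist (\<phi> x) (\<phi> y) \<le> lam * (1 + \<epsilon>) * dist x y" by (simp add: algebra_simps)
  qed (use lam \<open>\<epsilon> > 0\<close> in simp)
  show ?thesis
  proof (rule that[of \<phi>])
    show "cat_mor Ops ?V (range iota) \<phi>"
      unfolding cat_mor_def
    proof (intro conjI ballI allI impI)
      show "\<exists>C. C-lipschitz_on ?V \<phi>" using lip by blast
    next
      fix rs xs assume "rs \<in> Ops" "length xs = length rs \<and> set xs \<subseteq> ?V"
      then show "\<phi> (lincomb rs xs) = lincomb rs (map \<phi> xs)"
        by (simp add: \<phi>_def hop linear_lincomb[OF lin] o_def)
    qed (auto simp: \<phi>_def)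
    show "lip_norm ?V \<phi> \<le> lam * (1 + \<epsilon>)" by (rule lip_norm_bdd(2)[OF lip])
    show "\<phi> e = e" if "e \<in> ?V \<inter> range iota" for e
      using that by (auto simp: \<phi>_def h(3) T(2))
  qed
qed

section \<open>The canonical embedding as a morphism\<close>

lemma lip_norm_canon_emb:
  "lip_norm UNIV (canon_emb :: 'a::real_normed_vector \<Rightarrow> _) \<le> 1"
  "1-lipschitz_on UNIV (canon_emb :: 'a \<Rightarrow> _)"
proof -
  show "1-lipschitz_on UNIV (canon_emb :: 'a \<Rightarrow> _)"
    by (rule lipschitz_onI)
      (auto simp: dist_norm norm_canon_emb_le linear_diff[OF linear_canon_emb, symmetric])
  then show "lip_norm UNIV (canon_emb :: 'a \<Rightarrow> _) \<le> 1"
    by (rule lip_norm_bdd(2))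
qed

lemma cat_mor_canon_emb: "cat_mor Ops UNIV UNIV canon_emb"
  unfolding cat_mor_def using lip_norm_canon_emb(2) linear_lincomb[OF linear_canon_emb] by auto

lemma ext_prop_bidual:
  fixes iota :: "'y::real_normed_vector \<Rightarrow> 'x::real_normed_vector"
  assumes "ext_prop Ops iota lam TYPE('y \<Rightarrow>\<^sub>L real)" "lam \<ge> 0"
  shows "\<exists>h. cat_mor Ops UNIV UNIV h \<and> lip_norm UNIV h \<le> lam \<and> (\<forall>y. h (iota y) = canon_emb y)"
proof -
  obtain h where h: "cat_mor Ops UNIV UNIV h" "\<And>y. h (iota y) = canon_emb y"
    "lip_norm UNIV h \<le> lam * lip_norm UNIV (canon_emb :: 'y \<Rightarrow> _)"
    using assms(1) cat_mor_canon_emb unfolding ext_prop_def by blast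
  have "lam * lip_norm UNIV (canon_emb :: 'y \<Rightarrow> _) \<le> lam"
    using mult_left_mono[OF lip_norm_canon_emb(1) assms(2)] by simp
  with h show ?thesis by (intro exI[of _ h]) auto
qed

section \<open>From local almost-retractions to a global extension\<close>

lemma le_if_le_add_mult:
  fixes a b c :: real
  assumes "\<And>\<eta>. \<eta> > 0 \<Longrightarrow> a \<le> b + \<eta> * c" shows "a \<le> b"
proof (rule field_le_epsilon)
  fix e :: real assume "e > 0"
  have "a \<le> b + e / (\<bar>c\<bar> + 1) * c" using \<open>e > 0\<close> by (intro assms) simp
  also have "e / (\<bar>c\<bar> + 1) * c = e * (c / (\<bar>c\<bar> + 1))" by simp
  also have "\<dots> \<le> e * 1" using \<open>e > 0\<close> by (intro mult_left_mono) auto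
  finally show "a \<le> b + e" by simp
qed

lemma ext_prop_if_local_approx:
  fixes iota :: "'y::real_normed_vector \<Rightarrow> 'x::real_normed_vector"
  assumes iota_lin: "bounded_linear iota" and iota_isom: "\<And>y. norm (iota y) = norm y"
    and lam: "lam \<ge> 0"
    and loc: "\<And>\<epsilon> G. \<epsilon> > 0 \<Longrightarrow> finite G \<Longrightarrow> \<exists>V \<phi>. G \<subseteq> V \<and> op_closed Ops V \<and> cat_mor Ops V (range iota) \<phi> \<and>
                lip_norm V \<phi> \<le> lam * (1 + \<epsilon>) \<and> (\<forall>e \<in> V \<inter> range iota. norm (\<phi> e - e) < \<epsilon>)"
  shows "ext_prop Ops iota lam TYPE('z::real_normed_vector)"
  unfolding ext_prop_def
proof (intro allI impI)
  fix f :: "'y \<Rightarrow> 'z \<Rightarrow>\<^sub>L real" assume f: "cat_mor Ops UNIV UNIV f"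
  define L where "L = lip_norm UNIV f"
  obtain fL: "L-lipschitz_on UNIV f"
    and fop: "\<And>rs xs. rs \<in> Ops \<Longrightarrow> length xs = length rs \<Longrightarrow> f (lincomb rs xs) = lincomb rs (map f xs)"
    using f unfolding L_def by (elim cat_morE) auto
  have L: "L \<ge> 0" using lipschitz_on_nonneg[OF fL] .
  have fLn: "norm (f x - f y) \<le> L * norm (x - y)" for x y
    using lipschitz_onD[OF fL, of x y] by (simp add: dist_norm)
  have lin: "linear iota" using iota_lin by (rule bounded_linear.linear)
  have inj: "inj iota" unfolding linear_injective_0[OF lin] by (metis iota_isom norm_eq_zero)
  have iota_dist: "norm (iota x - iota y) = norm (x - y)" for x y
    by (metis iota_isom lin linear_diff)

  \<comment> \<open>Indices pair a set with a number. Along \<open>F\<close> the sets run through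
    the finite ones, ordered by inclusion, and the tolerance \<open>e i\<close> tends to 0 within
    the interval (0, 1].\<close>
  define e where "e i = 1 / (real (snd i) + 1)" for i :: "'x set \<times> nat"
  define F where "F = (finite_subsets_at_top (UNIV :: 'x set) \<times>\<^sub>F sequentially)"
  have "F \<noteq> bot" unfolding F_def by (simp add: prod_filter_eq_bot)
  have e: "0 < e i" "e i \<le> 1" for i by (auto simp: e_def)
  have ev_e: "eventually (\<lambda>i. e i < \<eta>) F" if "\<eta> > 0" for \<eta>
  proof -
    have "(\<lambda>n. 1 / (real n + 1)) \<longlonglongrightarrow> 0"
      by (rule LIMSEQ_inverse_real_of_nat[unfolded inverse_eq_divide of_nat_Suc add.commute[of 1]])
    then have "eventually (\<lambda>n. 1 / (real n + 1) < \<eta>) sequentially" using that by (rule order_tendstoD)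
    then show ?thesis
      unfolding F_def e_def by (rule eventually_compose_filterlim[OF _ filterlim_snd])
  qed
  have ev_in: "eventually (\<lambda>i. x \<in> fst i \<and> finite (fst i)) F" for x
  proof -
    have "eventually (\<lambda>G. x \<in> G \<and> finite G) (finite_subsets_at_top UNIV)"
      unfolding eventually_finite_subsets_at_top by (intro exI[of _ "{x}"]) auto
    then show ?thesis unfolding F_def by (rule eventually_compose_filterlim[OF _ filterlim_fst])
  qed
  have "\<exists>V \<psi>. (finite (fst i) \<longrightarrow> insert 0 (fst i) \<subseteq> V) \<and> op_closed Ops V \<and>
     cat_mor Ops V (range iota) (\<lambda>x. iota (\<psi> x)) \<and>
     lip_norm V (\<lambda>x. iota (\<psi> x)) \<le> lam * (1 + e i) \<and> (\<forall>y. iota y \<in> V \<longrightarrow> norm (\<psi> (iota y) - y) < e i)" for i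
  proof -
    \<comment> \<open>Adjoining \<open>0\<close> gives a common point of the domains, needed for the
      bound \<open>M\<close> below. Infinite sets, which \<open>F\<close> eventually excludes, are
      given the empty set as a default.\<close>
    define G where "G = (if finite (fst i) then insert 0 (fst i) else {})"
    have "finite G" by (simp add: G_def)
    then obtain V \<phi> where V: "G \<subseteq> V" "op_closed Ops V" and mor: "cat_mor Ops V (range iota) \<phi>"
      and lip: "lip_norm V \<phi> \<le> lam * (1 + e i)" and near: "\<forall>x \<in> V \<inter> range iota. norm (\<phi> x - x) < e i"
      using loc[OF e(1)] by metis
    \<comment> \<open>\<open>\<psi>\<close> is \<open>\<phi>\<close> read in \<open>Y\<close>
      itself; it is meaningful only on \<open>V\<close>, where \<open>\<phi>\<close> takes values in
      the range of \<open>iota\<close>.\<close>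
    define \<psi> where "\<psi> x = inv iota (\<phi> x)" for x
    have \<psi>: "iota (\<psi> x) = \<phi> x" if "x \<in> V" for x
      unfolding \<psi>_def using mor that by (intro f_inv_into_f) (auto simp: cat_mor_def)
    have "lip_norm V (\<lambda>x. iota (\<psi> x)) = lip_norm V \<phi>"
    unfolding lip_norm_def
      by (intro arg_cong[where f = Sup] arg_cong[where f = "insert 0"] Collect_cong ex_cong1) (auto simp: \<psi>)
    moreover have "cat_mor Ops V (range iota) (\<lambda>x. iota (\<psi> x))"
      unfolding cat_mor_def
    proof (intro conjI ballI allI impI)
      show "\<exists>C. C-lipschitz_on V (\<lambda>x. iota (\<psi> x))"
        using mor \<psi> unfolding cat_mor_def lipschitz_on_def by auto
    next
      fix rs xs assume *: "rs \<in> Ops" "length xs = length rs \<and> set xs \<subseteq> V"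
      then have "lincomb rs xs \<in> V" using V(2) by (auto simp: op_closed_def)
      then have "iota (\<psi> (lincomb rs xs)) = \<phi> (lincomb rs xs)" by (rule \<psi>)
      also have "\<dots> = lincomb rs (map \<phi> xs)" using mor * unfolding cat_mor_def by blast
      also have "map \<phi> xs = map (\<lambda>x. iota (\<psi> x)) xs" using * \<psi> by auto
      finally show "iota (\<psi> (lincomb rs xs)) = lincomb rs (map (\<lambda>x. iota (\<psi> x)) xs)" .
    qed auto
    moreover have "norm (\<psi> (iota y) - y) < e i" if "iota y \<in> V" for y
      using bspec[OF near, of "iota y"] \<psi>[OF that] iota_dist[of "\<psi> (iota y)" y] that by simp
    ultimately show ?thesis using V lip
      by (intro exI[of _ V] exI[of _ \<psi>]) (auto simp: G_def)
  qed
  then obtain V \<psi> where V: "\<And>i. finite (fst i) \<Longrightarrow> insert 0 (fst i) \<subseteq> V i" "\<And>i. op_closed Ops (V i)"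
    and mor: "\<And>i. cat_mor Ops (V i) (range iota) (\<lambda>x. iota (\<psi> i x))"
    and lip: "\<And>i. lip_norm (V i) (\<lambda>x. iota (\<psi> i x)) \<le> lam * (1 + e i)"
    and near: "\<And>i y. iota y \<in> V i \<Longrightarrow> norm (\<psi> i (iota y) - y) < e i" by metis
  have \<psi>L: "norm (\<psi> i x - \<psi> i y) \<le> lam * (1 + e i) * norm (x - y)" if "x \<in> V i" "y \<in> V i" for i x y
  proof -
    have "norm (\<psi> i x - \<psi> i y) = dist (iota (\<psi> i x)) (iota (\<psi> i y))" by (simp add: dist_norm iota_dist)
    also have "\<dots> \<le> lip_norm (V i) (\<lambda>x. iota (\<psi> i x)) * dist x y"
      using mor[of i] that by (elim cat_morE) (rule lipschitz_onD)
    also have "\<dots> \<le> lam * (1 + e i) * dist x y" using lip by (intro mult_right_mono) auto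
    finally show ?thesis by (simp add: dist_norm)
  qed
  have \<psi>op: "\<psi> i (lincomb rs xs) = lincomb rs (map (\<psi> i) xs)"
    if "rs \<in> Ops" "length xs = length rs" "set xs \<subseteq> V i" for i rs xs
  proof -
    have "iota (\<psi> i (lincomb rs xs)) = lincomb rs (map (\<lambda>x. iota (\<psi> i x)) xs)"
      using mor[of i] that by (elim cat_morE) blast
    also have "\<dots> = iota (lincomb rs (map (\<psi> i) xs))"
      using that by (simp add: linear_lincomb[OF lin] o_def)
    finally show ?thesis using inj by (simp add: inj_eq)
  qed

  \<comment> \<open>The default 0 keeps the family bounded at each point; each \<open>x\<close>
    eventually lies in \<open>V i\<close>, so the limit does not see it.\<close>
  define U where "U i x = (if finite (fst i) \<and> x \<in> V i then f (\<psi> i x) else 0)" for i x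
  \<comment> \<open>\<open>\<psi> i 0\<close> is within \<open>e i \<le> 1\<close> of
    \<open>0\<close>, and the Lipschitz constant \<open>lam * (1 + e i)\<close> is at most
    \<open>2 * lam\<close>.\<close>
  define M where "M x = norm (f 0) + L * (2 * lam * norm x + 1)" for x :: 'x
  have M0: "M x \<ge> 0" for x using L lam by (simp add: M_def)
  have UM: "norm (U i x) \<le> M x" for i x
  proof (cases "finite (fst i) \<and> x \<in> V i")
    case True
    then have 0: "0 \<in> V i" using V by blast
    have "norm (\<psi> i 0) < e i" using near[of 0 i] 0 linear_0[OF lin] by simp
    moreover have "norm (\<psi> i x - \<psi> i 0) \<le> lam * (1 + e i) * norm x" using \<psi>L[of x i 0] True 0 by simp
    moreover have "lam * (1 + e i) * norm x \<le> lam * 2 * norm x"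
      using e(2)[of i] lam by (intro mult_right_mono mult_left_mono) auto
    ultimately have "norm (\<psi> i x) \<le> 2 * lam * norm x + 1"
      using norm_triangle_sub[of "\<psi> i x" "\<psi> i 0"] e(2)[of i] by (simp add: algebra_simps)
    then have "L * norm (\<psi> i x) \<le> L * (2 * lam * norm x + 1)" using L by (rule mult_left_mono)
    then show ?thesis
      using norm_triangle_sub[of "f (\<psi> i x)" "f 0"] fLn[of "\<psi> i x" 0] True by (simp add: U_def M_def)
  next
    case False
    then show ?thesis using M0 by (auto simp: U_def)
  qed
  have UM_pair: "\<bar>(\<lambda>(x, z). U i x z) a\<bar> \<le> (\<lambda>(x, z). M x * norm z) a" for i a
    using norm_blinfun[of "U i (fst a)" "snd a"] mult_right_mono[OF UM, of "norm (snd a)" i "fst a"]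
    by (simp add: case_prod_unfold)
  \<comment> \<open>A weak* cluster point in \<open>Z*\<close> becomes a pointwise cluster point of
    real functions on the pairs \<open>(x, z)\<close>.\<close>
  obtain v G where "G \<noteq> bot" and lim: "\<And>a. ((\<lambda>w. w a) \<longlongrightarrow> v a) G"
    and ev: "\<And>P. eventually (\<lambda>i. P (\<lambda>(x, z). U i x z)) F \<Longrightarrow> eventually P G"
    by (rule pointwise_cluster_filter[OF \<open>F \<noteq> bot\<close> UM_pair]) (rule that)

  \<comment> \<open>Linearity in \<open>z\<close> holds for every index, because
    \<open>U i x\<close> is a functional, and passes to the limit; with the bound \<open>M x\<close>
    it makes \<open>h x\<close> an element of \<open>Z*\<close>.\<close>
  have v_add: "v (x, z + z') = v (x, z) + v (x, z')" for x z z'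
  proof (rule tendsto_unique[OF \<open>G \<noteq> bot\<close> lim])
    have "eventually (\<lambda>w. w (x, z) + w (x, z') = w (x, z + z')) G"
      by (intro ev always_eventually) (simp add: blinfun.bilinear_simps)
    then show "((\<lambda>w. w (x, z + z')) \<longlongrightarrow> v (x, z) + v (x, z')) G"
      by (rule Lim_transform_eventually[OF tendsto_add[OF lim lim]])
  qed
  have v_scale: "v (x, c *\<^sub>R z) = c *\<^sub>R v (x, z)" for x c z
  proof (rule tendsto_unique[OF \<open>G \<noteq> bot\<close> lim])
    have "eventually (\<lambda>w. c *\<^sub>R w (x, z) = w (x, c *\<^sub>R z)) G"
      by (intro ev always_eventually) (simp add: blinfun.bilinear_simps)
    then show "((\<lambda>w. w (x, c *\<^sub>R z)) \<longlongrightarrow> c *\<^sub>R v (x, z)) G"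
      by (rule Lim_transform_eventually[OF tendsto_scaleR[OF tendsto_const lim]])
  qed
  have v_bound: "norm (v (x, z)) \<le> norm z * M x" for x z
  proof (rule tendsto_upperbound[OF tendsto_norm[OF lim] _ \<open>G \<noteq> bot\<close>])
    show "eventually (\<lambda>w. norm (w (x, z)) \<le> norm z * M x) G"
      using UM_pair[of _ "(x, z)"] by (intro ev always_eventually) (simp add: mult.commute)
  qed
  define h where "h x = Blinfun (\<lambda>z. v (x, z))" for x
  have h: "h x z = v (x, z)" for x z
    unfolding h_def using v_add v_scale v_bound
    by (subst bounded_linear_Blinfun_apply) (auto intro!: bounded_linear_intro)

  have h_iota: "h (iota y) = f y" for y
  proof (rule blinfun_eqI)
    fix z
    have "\<bar>v (iota y, z) - f y z\<bar> \<le> 0 + \<eta> * (L * norm z)" if "\<eta> > 0" for \<eta>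
    proof (rule tendsto_upperbound[OF tendsto_rabs[OF tendsto_diff[OF lim tendsto_const]] _ \<open>G \<noteq> bot\<close>])
      show "eventually (\<lambda>w. \<bar>w (iota y, z) - f y z\<bar> \<le> 0 + \<eta> * (L * norm z)) G"
      proof (rule ev, use ev_in[of "iota y"] ev_e[OF that] in eventually_elim)
        case (elim i)
        then have "iota y \<in> V i" using V by blast
        then have "norm (f (\<psi> i (iota y)) - f y) \<le> L * \<eta>"
          using fLn[of "\<psi> i (iota y)" y] near[of y i] elim
            mult_left_mono[OF _ L, of "norm (\<psi> i (iota y) - y)" \<eta>] by simp
        then have "norm (f (\<psi> i (iota y)) - f y) * norm z \<le> L * \<eta> * norm z" by (rule mult_right_mono) simp
        then show ?case using norm_blinfun[of "f (\<psi> i (iota y)) - f y" z] elim \<open>iota y \<in> V i\<close>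
          by (simp add: U_def blinfun.bilinear_simps algebra_simps)
      qed
    qed
    then have "\<bar>v (iota y, z) - f y z\<bar> \<le> 0" by (rule le_if_le_add_mult)
    then show "h (iota y) z = f y z" by (simp add: h)
  qed
  have h_lip: "(lam * L)-lipschitz_on UNIV h"
  proof (rule lipschitz_onI)
    fix x y
    have "norm (h x - h y) \<le> lam * L * norm (x - y)"
    proof (rule norm_blinfun_bound)
      fix z
      \<comment> \<open>Norm bounds survive weak* limits when tested at each \<open>z\<close>. Here
        the bound holds eventually with the extra factor \<open>1 + \<eta>\<close>, which is removed
        at the end.\<close>
      have "\<bar>v (x, z) - v (y, z)\<bar> \<le> lam * L * norm (x - y) * norm z + \<eta> * (lam * L * norm (x - y) * norm z)" if "\<eta> > 0" for \<eta>
      proof (rule tendsto_upperbound[OF tendsto_rabs[OF tendsto_diff[OF lim lim]] _ \<open>G \<noteq> bot\<close>])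
        show "eventually (\<lambda>w. \<bar>w (x, z) - w (y, z)\<bar> \<le> lam * L * norm (x - y) * norm z + \<eta> * (lam * L * norm (x - y) * norm z)) G"
        proof (rule ev, use ev_in[of x] ev_in[of y] ev_e[OF that] in eventually_elim)
          case (elim i)
          then have xy: "x \<in> V i" "y \<in> V i" using V by blast+
          have "norm (f (\<psi> i x) - f (\<psi> i y)) \<le> L * norm (\<psi> i x - \<psi> i y)" by (rule fLn)
          also have "\<dots> \<le> L * (lam * (1 + e i) * norm (x - y))" using \<psi>L[OF xy] L by (rule mult_left_mono)
          also have "\<dots> \<le> L * (lam * (1 + \<eta>) * norm (x - y))"
            using elim L lam by (intro mult_left_mono mult_right_mono) auto
          finally have "norm (f (\<psi> i x) - f (\<psi> i y)) * norm z \<le> L * (lam * (1 + \<eta>) * norm (x - y)) * norm z"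
            by (rule mult_right_mono) simp
          then show ?case using norm_blinfun[of "f (\<psi> i x) - f (\<psi> i y)" z] elim xy
            by (simp add: U_def blinfun.bilinear_simps algebra_simps)
        qed
      qed
      then have "\<bar>v (x, z) - v (y, z)\<bar> \<le> lam * L * norm (x - y) * norm z" by (rule le_if_le_add_mult)
      then show "norm ((h x - h y) z) \<le> lam * L * norm (x - y) * norm z" by (simp add: h blinfun.bilinear_simps)
    qed (use lam L in simp)
    then show "dist (h x) (h y) \<le> lam * L * dist x y" by (simp add: dist_norm)
  qed (use lam L in simp)
  have h_op: "h (lincomb rs xs) = lincomb rs (map h xs)" if rs: "rs \<in> Ops" "length xs = length rs" for rs xs
  proof (rule blinfun_eqI)
    fix z
    have "v (lincomb rs xs, z) = (\<Sum>i<length rs. rs ! i *\<^sub>R v (xs ! i, z))"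
    proof (rule tendsto_unique[OF \<open>G \<noteq> bot\<close> lim])
      \<comment> \<open>Only the entries of \<open>xs\<close> must belong to \<open>fst i\<close>:
        closure of \<open>V i\<close> under the operations supplies their combination. For empty
        \<open>xs\<close>, finiteness of \<open>fst i\<close> comes from
        \<open>ev_in[of 0]\<close>.\<close>
      have ev_xs: "eventually (\<lambda>i. \<forall>x\<in>set xs. x \<in> fst i \<and> finite (fst i)) F"
        using ev_in by (intro eventually_ball_finite) auto
      have "eventually (\<lambda>w. (\<Sum>j<length rs. rs ! j *\<^sub>R w (xs ! j, z)) = w (lincomb rs xs, z)) G"
      proof (rule ev, use ev_xs ev_in[of 0] in eventually_elim)
        case (elim i)
        then have fin: "finite (fst i)" and sub: "set xs \<subseteq> V i" using V by blast+
        then have in_V: "xs ! j \<in> V i" if "j < length rs" for j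
          using that rs(2) by (metis nth_mem subsetD)
        have "lincomb rs xs \<in> V i" using sub V(2) rs unfolding op_closed_def by blast
        then have "U i (lincomb rs xs) z = f (lincomb rs (map (\<psi> i) xs)) z"
          using fin rs sub by (simp add: U_def \<psi>op)
        also have "\<dots> = (\<Sum>j<length rs. rs ! j *\<^sub>R f (\<psi> i (xs ! j)) z)"
          unfolding fop[OF rs(1), of "map (\<psi> i) xs", simplified, OF rs(2)]
          using rs(2) by (simp add: lincomb_eq_sum blinfun.sum_left blinfun.scaleR_left)
        also have "\<dots> = (\<Sum>j<length rs. rs ! j *\<^sub>R U i (xs ! j) z)"
          using fin in_V by (simp add: U_def)
        finally show ?case by simp
      qed
      then show "((\<lambda>w. w (lincomb rs xs, z)) \<longlongrightarrow> (\<Sum>j<length rs. rs ! j *\<^sub>R v (xs ! j, z))) G"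
        by (rule Lim_transform_eventually[rotated]) (intro tendsto_intros lim)
    qed
    then show "h (lincomb rs xs) z = lincomb rs (map h xs) z"
      using rs(2) by (simp add: lincomb_eq_sum blinfun.sum_left blinfun.scaleR_left h)
  qed
  show "\<exists>h. cat_mor Ops UNIV UNIV h \<and> (\<forall>y. h (iota y) = f y) \<and> lip_norm UNIV h \<le> lam * lip_norm UNIV f"
  proof (intro exI[of _ h] conjI)
    show "cat_mor Ops UNIV UNIV h" unfolding cat_mor_def using h_lip h_op by blast
    show "lip_norm UNIV h \<le> lam * lip_norm UNIV f" using lip_norm_bdd(2)[OF h_lip] by (simp add: L_def)
  qed (use h_iota in simp)
qed

text \<open>Condition (1) ranges over all Banach spaces \<open>Z\<close>, hence over types, and so
  appears twice: its instance \<open>Z = Y*\<close> suffices for (2), and (2) gives it for an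
  arbitrary type \<open>'z\<close>. \<open>AxX\<close> and \<open>AxB\<close> are the axioms of the
  category read in \<open>X\<close> and in \<open>Y**\<close>.\<close>

theorem theorem3p1:
  fixes Ops :: "real list set"
    and AxX :: "'x::banach set \<Rightarrow> bool"
    and AxB :: "(('y::banach \<Rightarrow>\<^sub>L real) \<Rightarrow>\<^sub>L real) set \<Rightarrow> bool"
    and iota :: "'y \<Rightarrow> 'x"
    and lam :: real
  assumes banachX: "\<And>S. closed S \<Longrightarrow> subspace S \<Longrightarrow> AxX S"
    and banachB: "\<And>S. closed S \<Longrightarrow> subspace S \<Longrightarrow> AxB S"
    and nice: "\<And>A B f D. cat_obj Ops AxX A \<Longrightarrow> cat_obj Ops AxB B \<Longrightarrow> cat_mor Ops A B f
                 \<Longrightarrow> D \<subseteq> B \<Longrightarrow> cat_obj Ops AxB D \<Longrightarrow> cat_obj Ops AxX (A \<inter> f -` D)"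
    and iota_lin: "bounded_linear iota"
    and iota_isom: "\<And>y. norm (iota y) = norm y"
    and lam: "lam \<ge> 1"
  defines "P2 \<equiv> (\<exists>h :: 'x \<Rightarrow> (('y \<Rightarrow>\<^sub>L real) \<Rightarrow>\<^sub>L real).
                   cat_mor Ops UNIV UNIV h \<and> lip_norm UNIV h \<le> lam \<and>
                   (\<forall>y. h (iota y) = canon_emb y))"
    and "P3 \<equiv> (\<forall>\<epsilon>>0. \<forall>G. finite G \<longrightarrow>
                   (\<exists>V \<phi>. G \<subseteq> V \<and> cat_obj Ops AxX V \<and> cat_mor Ops V (range iota) \<phi> \<and>
                          lip_norm V \<phi> \<le> lam * (1 + \<epsilon>) \<and>
                          (\<forall>e \<in> V \<inter> range iota. \<phi> e = e)))"
    and "P4 \<equiv> (\<forall>\<epsilon>>0. \<forall>G. finite G \<longrightarrow>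
                   (\<exists>V \<phi>. G \<subseteq> V \<and> cat_obj Ops AxX V \<and> cat_mor Ops V (range iota) \<phi> \<and>
                          lip_norm V \<phi> \<le> lam * (1 + \<epsilon>) \<and>
                          (\<forall>e \<in> V \<inter> range iota. norm (\<phi> e - e) < \<epsilon>)))"
  shows "(ext_prop Ops iota lam TYPE('y \<Rightarrow>\<^sub>L real) \<longrightarrow> P2)
       \<and> (P2 \<longrightarrow> ext_prop Ops iota lam TYPE('z::banach))
       \<and> (P2 \<longleftrightarrow> P3) \<and> (P3 \<longleftrightarrow> P4)"
proof -
  have lam0: "lam \<ge> 0" using lam by simp
  have 12: "P2" if "ext_prop Ops iota lam TYPE('y \<Rightarrow>\<^sub>L real)"
    unfolding P2_def using that lam0 by (rule ext_prop_bidual)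
  have 23: P3 if P2: P2
    unfolding P3_def
  proof (intro allI impI)
    fix \<epsilon> :: real and G :: "'x set" assume "\<epsilon> > 0" "finite G"
    obtain h :: "'x \<Rightarrow> (('y \<Rightarrow>\<^sub>L real) \<Rightarrow>\<^sub>L real)" where h: "cat_mor Ops UNIV UNIV h"
      "lip_norm UNIV h \<le> lam" "\<And>y. h (iota y) = canon_emb y"
      using P2 unfolding P2_def by blast
    let ?V = "h -` span (h ` G)"
    have fin: "finite (h ` G)" using \<open>finite G\<close> by simp
    obtain \<phi> where \<phi>: "cat_mor Ops ?V (range iota) \<phi>" "lip_norm ?V \<phi> \<le> lam * (1 + \<epsilon>)"
      "\<And>e. e \<in> ?V \<inter> range iota \<Longrightarrow> \<phi> e = e"
      using local_retraction_of_bidual_mor[OF iota_lin iota_isom h fin \<open>\<epsilon> > 0\<close>] by blast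
    have "cat_obj Ops AxX (UNIV \<inter> ?V)"
      by (rule nice[OF _ _ h(1)])
        (simp_all add: cat_obj_def banachX banachB op_closed_subspace closed_span_finite[OF fin])
    moreover have "G \<subseteq> ?V" by (auto intro: span_base)
    ultimately show "\<exists>V \<phi>. G \<subseteq> V \<and> cat_obj Ops AxX V \<and> cat_mor Ops V (range iota) \<phi> \<and>
        lip_norm V \<phi> \<le> lam * (1 + \<epsilon>) \<and> (\<forall>e \<in> V \<inter> range iota. \<phi> e = e)"
      using \<phi> by (intro exI[of _ ?V] exI[of _ \<phi>]) auto
  qed
  have 34: P4 if P3: P3
    unfolding P4_def
  proof (intro allI impI)
    fix \<epsilon> :: real and G :: "'x set" assume "\<epsilon> > 0" "finite G"
    with P3 obtain V \<phi> where "G \<subseteq> V" "cat_obj Ops AxX V" "cat_mor Ops V (range iota) \<phi>"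
      "lip_norm V \<phi> \<le> lam * (1 + \<epsilon>)" "\<forall>e \<in> V \<inter> range iota. \<phi> e = e"
      unfolding P3_def by meson
    with \<open>\<epsilon> > 0\<close> show "\<exists>V \<phi>. G \<subseteq> V \<and> cat_obj Ops AxX V \<and> cat_mor Ops V (range iota) \<phi> \<and>
        lip_norm V \<phi> \<le> lam * (1 + \<epsilon>) \<and> (\<forall>e \<in> V \<inter> range iota. norm (\<phi> e - e) < \<epsilon>)"
      by (intro exI[of _ V] exI[of _ \<phi>]) simp
  qed
  have loc: "\<exists>V \<phi>. G \<subseteq> V \<and> op_closed Ops V \<and> cat_mor Ops V (range iota) \<phi> \<and>
      lip_norm V \<phi> \<le> lam * (1 + \<epsilon>) \<and> (\<forall>e \<in> V \<inter> range iota. norm (\<phi> e - e) < \<epsilon>)"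
    if P4 "\<epsilon> > 0" "finite G" for \<epsilon> G
    using that unfolding P4_def cat_obj_def by meson
  have 41: "ext_prop Ops iota lam TYPE('z)" if P4
    by (rule ext_prop_if_local_approx[OF iota_lin iota_isom lam0 loc[OF that]])
  \<comment> \<open>The same extension result, now at \<open>Z = Y*\<close>, closes the cycle from
    (4) through (1) to (2).\<close>
  have 42: P2 if P4
    by (rule 12) (rule ext_prop_if_local_approx[OF iota_lin iota_isom lam0 loc[OF that]])
  from 12 23 34 41 42 show ?thesis by blast
qed

end
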